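(* Let $f:(M,g)\to(N,h)$ be a holomorphic map between Hermitian manifolds with $\dim_{\mathbb C}M=m\le n=\dim_{\mathbb C}N$, let $1\le \ell\le m$, and let $p\in M$. Let $(z^1,\dots,z^m)$ be local holomorphic coordinates of $M$ near $p$ and $(\omega^1,\dots,\omega^n)$ local holomorphic coordinates of $N$ near $f(p)$ such that $g_{\alpha\overline\beta}=\delta_{\alpha\beta}$ at $p$, $h_{i\overline j}=\delta_{ij}$ at $f(p)$, and at $p$ $$\partial f\Big(\frac{\partial}{\partial z^\alpha}\Big)=\sum_{i=1}^n\lambda_\alpha\delta_{i\alpha}\frac{\partial}{\partial\omega^i}\qquad(1\le\alpha\le m),$$ with $|\lambda_1|\ge\cdots\ge|\lambda_m|$ (so that $|\lambda_1|,\dots,|\lambda_m|$ are the singular values of $\partial f:(T'_pM,g)\to(T'_{f(p)}N,h)$). Let $W_\ell=\dfrac{\det(A_\ell)}{\det(G_\ell)}$, a function defined in a small neighborhood of $p$, where $A_{\ell}$ and $G_\ell$ are the upper-left $\ell\times\ell$ blocks of $A=(A_{\alpha\overline\beta})$ and $G=(g_{\alpha\overline\beta})$. If $W_\ell(p)\neq0$, then at $p$, for all $1\le\gamma,\delta\le m$, $$\frac{\partial^{2}}{\partial z^{\gamma}\partial\overline{z}^{\delta}}\log W_{\ell}=\sum_{\alpha=1}^{\ell}R^{M}(\gamma,\overline{\delta},\alpha,\overline{\alpha})-\sum_{\alpha=1}^{\ell}R^{N}(\gamma,\overline{\delta},\alpha,\overline{\alpha})\lambda_{\gamma}\overline{\lambda_{\delta}}-\sum_{\alpha=1}^{\ell}\sum_{t=\ell+1}^{m}g_{\alpha\overline{t},\gamma}\,g_{t\overline{\alpha},\overline{\delta}}$$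 $$\qquad\qquad+\sum_{\alpha=1}^{\ell}\sum_{i=\ell+1}^{n}\frac{1}{|\lambda_{\alpha}|^{2}}\big(f^{i}_{\alpha\gamma}+h_{\alpha\overline{i},\gamma}\lambda_{\alpha}\lambda_{\gamma}\big)\big(\overline{f^{i}_{\alpha\delta}}+h_{i\overline{\alpha},\overline{\delta}}\overline{\lambda_{\alpha}}\,\overline{\lambda_{\delta}}\big),$$ where $R^M$ and $R^N$ are the Chern curvature tensors of $(M,g)$ and $(N,h)$.
   Context: Notation. In the local coordinates, $f^i=\omega^i\circ f$, $f^i_\alpha=\partial f^i/\partial z^\alpha$, $f^i_{\alpha\gamma}=\partial^2 f^i/\partial z^\alpha\partial z^\gamma$; $\partial f:T'M\to T'N$ is the tangent map on holomorphic tangent bundles, $\partial f(\partial/\partial z^\alpha)=\sum_{i}f^i_\alpha\,\partial/\partial\omega^i$. The pull-back $f^*h$ has components $A_{\alpha\overline\beta}=\sum_{i,j=1}^n f^i_\alpha\overline{f^j_\beta}h_{i\overline j}$. Subscripts after a comma denote ordinary coordinate derivatives: $g_{\alpha\overline t,\gamma}=\partial g_{\alpha\overline t}/\partial z^\gamma$, $g_{t\overline\alpha,\overline\delta}=\partial g_{t\overline\alpha}/\partial\overline z^\delta$ (evaluated at $p$), and $h_{\alpha\overline i,\gamma}=\partial h_{\alpha\overline i}/\partial\omega^\gamma$, $h_{i\overline\alpha,\overline\delta}=\partial h_{i\overline\alpha}/\partial\overline\omega^\delta$ (evaluated at $f(p)$). The Chern curvature tensor of a Hermitian metric $g$ is $$R_{i\overline{j}k\overline{l}}=-\frac{\partial^{2}g_{k\overline{l}}}{\partial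 z^{i}\partial \overline{z}^{j}}+\sum_{p,q}g^{p\overline{q}}\frac{\partial g_{k\overline{q}}}{\partial z^{i}}\frac{\partial g_{p\overline{l}}}{\partial \overline{z}^{j}}.$$ $R^M(\gamma,\overline\delta,\alpha,\overline\alpha)=R^M_{\gamma\overline\delta\alpha\overline\alpha}$ is the component with respect to $\partial/\partial z^\gamma$, etc., at $p$; $R^N(\gamma,\overline\delta,\alpha,\overline\alpha)=R^N_{\gamma\overline\delta\alpha\overline\alpha}$ is the component with respect to $\partial/\partial\omega^\gamma$, etc., at $f(p)$. *)

theory Defs
  imports "HOL-Analysis.Analysis" "Jordan_Normal_Form.Determinant"
begin

section \<open>Calculus on open subsets of complex coordinate space\<close>

text \<open>Real partial derivative of \<open>F\<close> at \<open>z\<close> in the direction \<open>v\<close>.\<close>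

definition dir_deriv :: "complex^'m \<Rightarrow> (complex^'m \<Rightarrow> complex) \<Rightarrow> complex^'m \<Rightarrow> complex" where
  "dir_deriv v F z = vector_derivative (\<lambda>t::real. F (z + of_real t *s v)) (at 0)"

text \<open>The Wirtinger derivatives \<open>\<partial>/\<partial>z\<^sup>k\<close> and \<open>\<partial>/\<partial>z\<bar>\<^sup>k\<close>, where \<open>z\<^sup>k = x\<^sup>k + \<i> y\<^sup>k\<close>.\<close>

definition pd :: "'m \<Rightarrow> (complex^'m \<Rightarrow> complex) \<Rightarrow> complex^'m \<Rightarrow> complex" where
  "pd k F z = (dir_deriv (axis k 1) F z - \<i> * dir_deriv (axis k \<i>) F z) / 2"

definition pdbar :: "'m \<Rightarrow> (complex^'m \<Rightarrow> complex) \<Rightarrow> complex^'m \<Rightarrow> complex" where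
  "pdbar k F z = (dir_deriv (axis k 1) F z + \<i> * dir_deriv (axis k \<i>) F z) / 2"

definition jac :: "(complex^'m \<Rightarrow> complex^'n) \<Rightarrow> complex^'m \<Rightarrow> complex^'m^'n" where
  "jac F z = (\<chi> i j. pd j (\<lambda>w. F w $ i) z)"

text \<open>Holomorphy in several variables: the real differential exists and is complex linear.
  Used for open \<open>S\<close> only.\<close>

definition mholomorphic_on :: "(complex^'m \<Rightarrow> complex^'n) \<Rightarrow> (complex^'m) set \<Rightarrow> bool" where
  "mholomorphic_on F S \<longleftrightarrow>
    (\<forall>z\<in>S. \<exists>L. (F has_derivative L) (at z) \<and> (\<forall>k v. L (k *s v) = k *s L v))"

text \<open>Smoothness (over the reals), for open \<open>S\<close>.\<close>

fun Ck_on :: "nat \<Rightarrow> (complex^'m) set \<Rightarrow> (complex^'m \<Rightarrow> complex) \<Rightarrow> bool" where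
  "Ck_on 0 S F \<longleftrightarrow> continuous_on S F"
| "Ck_on (Suc k) S F \<longleftrightarrow>
    (\<forall>z\<in>S. F differentiable (at z)) \<and> (\<forall>v. Ck_on k S (\<lambda>z. frechet_derivative F (at z) v))"

definition smooth_on :: "(complex^'m) set \<Rightarrow> (complex^'m \<Rightarrow> complex) \<Rightarrow> bool" where
  "smooth_on S F \<longleftrightarrow> (\<forall>k. Ck_on k S F)"

section \<open>Complex manifolds and holomorphic maps\<close>

text \<open>A chart is a pair of a domain and a coordinate map; only the values of the coordinate map
  on the domain matter.\<close>

type_synonym ('a, 'm) chart = "'a set \<times> ('a \<Rightarrow> complex^'m)"

definition chart_inv :: "('a, 'm::finite) chart \<Rightarrow> complex^'m \<Rightarrow> 'a" where
  "chart_inv c = inv_into (fst c) (snd c)"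

definition is_chart :: "'a topology \<Rightarrow> ('a, 'm::finite) chart \<Rightarrow> bool" where
  "is_chart X c \<longleftrightarrow> openin X (fst c) \<and> open (snd c ` fst c) \<and>
    homeomorphic_map (subtopology X (fst c)) (top_of_set (snd c ` fst c)) (snd c)"

definition trans_map :: "('a, 'm::finite) chart \<Rightarrow> ('a, 'm) chart \<Rightarrow> complex^'m \<Rightarrow> complex^'m" where
  "trans_map c c' = snd c' \<circ> chart_inv c"

definition compatible :: "('a, 'm::finite) chart \<Rightarrow> ('a, 'm) chart \<Rightarrow> bool" where
  "compatible c c' \<longleftrightarrow>
    mholomorphic_on (trans_map c c') (snd c ` (fst c \<inter> fst c')) \<and>
    mholomorphic_on (trans_map c' c) (snd c' ` (fst c \<inter> fst c'))"

text \<open>The atlas is maximal, so its members are exactly the local holomorphic coordinate systems.\<close>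

definition complex_manifold :: "'a topology \<Rightarrow> ('a, 'm::finite) chart set \<Rightarrow> bool" where
  "complex_manifold X A \<longleftrightarrow>
    Hausdorff_space X \<and> second_countable X \<and>
    (\<forall>c\<in>A. is_chart X c) \<and> (\<Union>c\<in>A. fst c) = topspace X \<and>
    (\<forall>c\<in>A. \<forall>c'\<in>A. compatible c c') \<and>
    (\<forall>c. is_chart X c \<and> (\<forall>c'\<in>A. compatible c c') \<longrightarrow> c \<in> A)"

definition loc_rep ::
    "('a, 'm::finite) chart \<Rightarrow> ('b, 'n::finite) chart \<Rightarrow> ('a \<Rightarrow> 'b) \<Rightarrow> complex^'m \<Rightarrow> complex^'n" where
  "loc_rep c d f = snd d \<circ> f \<circ> chart_inv c"

definition holomorphic_map ::
    "'a topology \<Rightarrow> ('a, 'm::finite) chart set \<Rightarrow> 'b topology \<Rightarrow> ('b, 'n::finite) chart set \<Rightarrow>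
     ('a \<Rightarrow> 'b) \<Rightarrow> bool" where
  "holomorphic_map X A Y B f \<longleftrightarrow> continuous_map X Y f \<and>
    (\<forall>c\<in>A. \<forall>d\<in>B. mholomorphic_on (loc_rep c d f) (snd c ` (fst c \<inter> f -` fst d)))"

section \<open>Holomorphic tangent vectors\<close>

text \<open>A holomorphic tangent vector at \<open>p\<close> assigns to every chart around \<open>p\<close> its vector of
  components with respect to the coordinate vector fields \<open>\<partial>/\<partial>z\<^sup>k\<close> of that chart, subject to the
  usual transformation law. At irrelevant charts the value is fixed to 0, so that equality of
  tangent vectors is equality of functions.\<close>

type_synonym ('a, 'm) tvec = "('a, 'm) chart \<Rightarrow> complex^'m"

definition tangent_space :: "('a, 'm::finite) chart set \<Rightarrow> 'a \<Rightarrow> ('a, 'm) tvec set" where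
  "tangent_space A p = {v.
    (\<forall>c\<in>A. \<forall>c'\<in>A. p \<in> fst c \<inter> fst c' \<longrightarrow> v c' = jac (trans_map c c') (snd c p) *v v c) \<and>
    (\<forall>c. \<not> (c \<in> A \<and> p \<in> fst c) \<longrightarrow> v c = 0)}"

text \<open>The coordinate vector \<open>\<partial>/\<partial>z\<^sup>k\<close> of the chart \<open>c\<close> at the point \<open>p\<close>.\<close>

definition coord_vec ::
    "('a, 'm::finite) chart set \<Rightarrow> ('a, 'm) chart \<Rightarrow> 'a \<Rightarrow> 'm \<Rightarrow> ('a, 'm) tvec" where
  "coord_vec A c p k = (\<lambda>c'. if c' \<in> A \<and> p \<in> fst c'
     then jac (trans_map c c') (snd c p) *v axis k 1 else 0)"

text \<open>The tangent map \<open>\<partial>f\<close> at \<open>p\<close>, computed in an arbitrary chart around \<open>p\<close>; on tangent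
  vectors the result does not depend on which chart is chosen.\<close>

definition tangent_map ::
    "('a, 'm::finite) chart set \<Rightarrow> ('b, 'n::finite) chart set \<Rightarrow> ('a \<Rightarrow> 'b) \<Rightarrow> 'a \<Rightarrow>
     ('a, 'm) tvec \<Rightarrow> ('b, 'n) tvec" where
  "tangent_map A B f p v =
    (let c = (SOME c. c \<in> A \<and> p \<in> fst c)
     in (\<lambda>d. if d \<in> B \<and> f p \<in> fst d then jac (loc_rep c d f) (snd c p) *v v c else 0))"

section \<open>Hermitian metrics and Chern curvature\<close>

type_synonym ('a, 'm) metric = "'a \<Rightarrow> ('a, 'm) tvec \<Rightarrow> ('a, 'm) tvec \<Rightarrow> complex"

text \<open>\<open>g p u v\<close> is linear in \<open>u\<close> and conjugate linear in \<open>v\<close>, so the value below is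
  \<open>g(\<partial>/\<partial>z\<^sup>i, \<partial>/\<partial>z\<bar>\<^sup>j)\<close>, as a function of the coordinates.\<close>

definition metric_coeff ::
    "('a, 'm::finite) chart set \<Rightarrow> ('a, 'm) metric \<Rightarrow> ('a, 'm) chart \<Rightarrow> 'm \<Rightarrow> 'm \<Rightarrow>
     complex^'m \<Rightarrow> complex" where
  "metric_coeff A g c i j z =
    (let q = chart_inv c z in g q (coord_vec A c q i) (coord_vec A c q j))"

definition hermitian_metric ::
    "'a topology \<Rightarrow> ('a, 'm::finite) chart set \<Rightarrow> ('a, 'm) metric \<Rightarrow> bool" where
  "hermitian_metric X A g \<longleftrightarrow>
    (\<forall>p\<in>topspace X.
      (\<forall>u\<in>tangent_space A p. \<forall>u'\<in>tangent_space A p. \<forall>v\<in>tangent_space A p. \<forall>k.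
        g p (\<lambda>c. k *s u c + u' c) v = k * g p u v + g p u' v) \<and>
      (\<forall>u\<in>tangent_space A p. \<forall>v\<in>tangent_space A p. g p v u = cnj (g p u v)) \<and>
      (\<forall>u\<in>tangent_space A p. u \<noteq> (\<lambda>_. 0) \<longrightarrow> 0 < Re (g p u u))) \<and>
    (\<forall>c\<in>A. \<forall>i j. smooth_on (snd c ` fst c) (metric_coeff A g c i j))"

definition hermitian_manifold ::
    "'a topology \<Rightarrow> ('a, 'm::finite) chart set \<Rightarrow> ('a, 'm) metric \<Rightarrow> bool" where
  "hermitian_manifold X A g \<longleftrightarrow> complex_manifold X A \<and> hermitian_metric X A g"

text \<open>The inverse metric \<open>g\<^sup>p\<^sup>q\<^sup>\<bar>\<close> is normalised by \<open>\<Sum>q. g\<^sup>p\<^sup>q\<^sup>\<bar> g\<^sub>r\<^sub>q\<^sub>\<bar> = \<delta>\<^sub>p\<^sub>r\<close>; it is the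
  transpose of the inverse of the matrix with row index \<open>p\<close> and column index \<open>q\<close>.\<close>

definition metric_inv ::
    "('m::finite \<Rightarrow> 'm \<Rightarrow> complex^'m \<Rightarrow> complex) \<Rightarrow> 'm \<Rightarrow> 'm \<Rightarrow> complex^'m \<Rightarrow> complex" where
  "metric_inv G p q z = matrix_inv (\<chi> r s. G r s z) $ q $ p"

definition chern_curv ::
    "('m::finite \<Rightarrow> 'm \<Rightarrow> complex^'m \<Rightarrow> complex) \<Rightarrow> 'm \<Rightarrow> 'm \<Rightarrow> 'm \<Rightarrow> 'm \<Rightarrow>
     complex^'m \<Rightarrow> complex" where
  "chern_curv G i j k l z =
    - pd i (pdbar j (G k l)) z
    + (\<Sum>p\<in>UNIV. \<Sum>q\<in>UNIV. metric_inv G p q z * pd i (G k q) z * pdbar j (G p l) z)"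

section \<open>The pull-back metric and the quotient of minors\<close>

text \<open>Components of \<open>f\<^sup>*h\<close> in the chart \<open>c\<close>, computed through the chart \<open>d\<close> of the target.\<close>

definition pullback_coeff ::
    "('b, 'n::finite) chart set \<Rightarrow> ('b, 'n) metric \<Rightarrow> ('a, 'm::finite) chart \<Rightarrow> ('b, 'n) chart \<Rightarrow>
     ('a \<Rightarrow> 'b) \<Rightarrow> 'm \<Rightarrow> 'm \<Rightarrow> complex^'m \<Rightarrow> complex" where
  "pullback_coeff B h c d f \<alpha> \<beta> z =
    (\<Sum>i\<in>UNIV. \<Sum>j\<in>UNIV.
       pd \<alpha> (\<lambda>w. loc_rep c d f w $ i) z * cnj (pd \<beta> (\<lambda>w. loc_rep c d f w $ j) z) *
       metric_coeff B h d i j (loc_rep c d f z))"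

text \<open>Determinant of the upper-left \<open>l \<times> l\<close> block of \<open>F\<close>, where the coordinate indices are ordered
  as \<open>a 1, a 2, \<dots>\<close>. The shift is needed because \<open>mat\<close> indexes rows and columns from 0.\<close>

definition leading_minor ::
    "(nat \<Rightarrow> 'm) \<Rightarrow> nat \<Rightarrow> ('m \<Rightarrow> 'm \<Rightarrow> complex^'m \<Rightarrow> complex) \<Rightarrow> complex^'m \<Rightarrow> complex" where
  "leading_minor a l F z = Determinant.det (Matrix.mat l l (\<lambda>(r, s). F (a (Suc r)) (a (Suc s)) z))"

definition W_quot ::
    "('a, 'm::finite) chart set \<Rightarrow> ('a, 'm) metric \<Rightarrow> ('b, 'n::finite) chart set \<Rightarrow>
     ('b, 'n) metric \<Rightarrow> ('a, 'm) chart \<Rightarrow> ('b, 'n) chart \<Rightarrow> ('a \<Rightarrow> 'b) \<Rightarrow> (nat \<Rightarrow> 'm) \<Rightarrow> nat \<Rightarrow>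
     complex^'m \<Rightarrow> complex" where
  "W_quot A g B h c d f a l z =
    leading_minor a l (pullback_coeff B h c d f) z / leading_minor a l (metric_coeff A g c) z"

end

theory Submission
  imports Defs "HOL-Complex_Analysis.Complex_Analysis"
begin

text \<open>In coordinates, \<open>log W\<close> is a difference of two logarithms of leading minors, and \<open>W\<close> is positive at
  the point, so that the principal branch of the logarithm is differentiable nearby. For a matrix \<open>M\<close>
  that is diagonal with entries \<open>d\<^sub>i\<close> at the point,
  \<open>\<partial>\<^sub>\<gamma>\<partial>\<^sub>\<delta>\<^sub>\<bar> log det M = \<Sum>\<^sub>i \<partial>\<^sub>\<gamma>\<partial>\<^sub>\<delta>\<^sub>\<bar> M\<^sub>i\<^sub>i / d\<^sub>i - \<Sum>\<^sub>i\<^sub>j \<partial>\<^sub>\<delta>\<^sub>\<bar> M\<^sub>i\<^sub>j \<partial>\<^sub>\<gamma> M\<^sub>j\<^sub>i / (d\<^sub>i d\<^sub>j)\<close>.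
  For the pull-back metric the diagonal second derivatives are a full square
  \<open>\<Sum>\<^sub>i P\<^sup>i Q\<^sup>i\<close> over all \<open>i \<le> n\<close>, with \<open>P\<close> and \<open>Q\<close> the two factors of the last sum of the theorem,
  minus a curvature term; the double sum removes the part with \<open>i \<le> l\<close>. The same cancellation for \<open>g\<close>
  leaves the indices \<open>t > l\<close>. Twofold differentiability of the partial derivatives of \<open>f\<close> is not part of
  the definition of holomorphy used here and comes from Cauchy's integral formula in one variable.\<close>

no_notation fps_nth (infixl "$" 75)
no_notation vec_index (infixl "$" 100)

section \<open>Differentiation rules and chain rules for the first-order Wirtinger operators\<close>

section \<open>Wirtinger calculus\<close>

text \<open>\<open>e = - \<i>\<close> gives \<open>\<partial>/\<partial>z\<^sup>k\<close> and \<open>e = \<i>\<close> gives \<open>\<partial>/\<partial>z\<bar>\<^sup>k\<close>, so that the rules are proved only once.\<close>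

definition wirt :: "complex \<Rightarrow> 'm::finite \<Rightarrow> (complex^'m \<Rightarrow> complex) \<Rightarrow> complex^'m \<Rightarrow> complex" where
  "wirt e k F z = (dir_deriv (axis k 1) F z + e * dir_deriv (axis k \<i>) F z) / 2"

lemma pd_wirt: "pd k = wirt (- \<i>) k"
  by (simp add: fun_eq_iff pd_def wirt_def)

lemma pdbar_wirt: "pdbar k = wirt \<i> k"
  by (simp add: fun_eq_iff pdbar_def wirt_def)

lemma of_real_smult: "of_real t *s v = t *\<^sub>R (v :: complex^'m)"
  by (simp only: Finite_Cartesian_Product.vec_eq_iff vector_smult_component vector_scaleR_component)
    (simp add: scaleR_conv_of_real)

text \<open>Chain rule along the real line through \<open>z\<close>. It replaces a derivative on a
  single line by a value of the real differential, so that every later rule becomes a computation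
  with linear maps.\<close>

lemma dir_deriv_has_derivative:
  assumes "(F has_derivative L) (at z)"
  shows "dir_deriv v F z = L v"
proof -
  have "((\<lambda>t::real. z + t *\<^sub>R v) has_derivative (\<lambda>t. t *\<^sub>R v)) (at 0)"
    by (auto intro!: derivative_eq_intros)
  moreover have "(F has_derivative L) (at (z + 0 *\<^sub>R v))"
    using assms by simp
  ultimately have "((\<lambda>t::real. F (z + t *\<^sub>R v)) has_derivative (\<lambda>t. L (t *\<^sub>R v))) (at 0)"
    using has_derivative_compose by blast
  moreover have "L (t *\<^sub>R v) = t *\<^sub>R L v" for t
    using has_derivative_linear[OF assms] by (rule linear_scale)
  ultimately show ?thesis
    unfolding dir_deriv_def of_real_smult by (intro vector_derivative_at) (simp add: has_vector_derivative_def)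
qed

lemma wirt_has_derivative:
  assumes "(F has_derivative L) (at z)"
  shows "wirt e k F z = (L (axis k 1) + e * L (axis k \<i>)) / 2"
  by (simp add: wirt_def dir_deriv_has_derivative[OF assms])

text \<open>For small real \<open>t\<close> the point \<open>z + t v\<close> stays in the open set,
  so only values near \<open>z\<close> matter. This permits a second differentiation of formulas
  that are known only on an open neighbourhood.\<close>

lemma wirt_cong:
  assumes "open S" "z \<in> S" "\<And>x. x \<in> S \<Longrightarrow> F x = G x"
  shows "wirt e k F z = wirt e k G z"
proof -
  have "dir_deriv v F z = dir_deriv v G z" for v
  proof -
    have "((\<lambda>t::real. z + t *\<^sub>R v) \<longlongrightarrow> z + 0 *\<^sub>R v) (nhds 0)"
      by (intro tendsto_intros filterlim_ident)
    then have "((\<lambda>t::real. z + of_real t *s v) \<longlongrightarrow> z) (nhds 0)"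
      by (simp add: of_real_smult)
    then have "\<forall>\<^sub>F t in nhds 0. z + of_real t *s v \<in> S"
      using assms(1,2) by (rule topological_tendstoD)
    then have "\<forall>\<^sub>F t in nhds 0. F (z + of_real t *s v) = G (z + of_real t *s v)"
      by eventually_elim (rule assms(3))
    then show ?thesis
      unfolding dir_deriv_def by (intro vector_derivative_cong_eq) (auto elim: eventually_mono)
  qed
  then show ?thesis by (simp add: wirt_def)
qed

lemma wirt_const [simp]: "wirt e k (\<lambda>x. c) z = 0"
  by (simp add: wirt_has_derivative[OF has_derivative_const])

lemma wirt_add:
  assumes "F differentiable at z" "G differentiable at z"
  shows "wirt e k (\<lambda>x. F x + G x) z = wirt e k F z + wirt e k G z"
proof -
  obtain L K where L: "(F has_derivative L) (at z)" "(G has_derivative K) (at z)"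
    using assms by (auto simp: differentiable_def)
  show ?thesis
    unfolding wirt_has_derivative[OF L(1)] wirt_has_derivative[OF L(2)]
      wirt_has_derivative[OF has_derivative_add[OF L]]
    by (simp add: field_simps)
qed

lemma wirt_mult:
  assumes "F differentiable at z" "G differentiable at z"
  shows "wirt e k (\<lambda>x. F x * G x) z = wirt e k F z * G z + F z * wirt e k G z"
proof -
  obtain L K where L: "(F has_derivative L) (at z)" "(G has_derivative K) (at z)"
    using assms by (auto simp: differentiable_def)
  show ?thesis
    unfolding wirt_has_derivative[OF L(1)] wirt_has_derivative[OF L(2)]
      wirt_has_derivative[OF has_derivative_mult[OF L]]
    by (simp add: field_simps)
qed

lemma wirt_cmult:
  assumes "F differentiable at z"
  shows "wirt e k (\<lambda>x. c * F x) z = c * wirt e k F z"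
  using wirt_mult[OF differentiable_const assms] by simp

lemma wirt_sum:
  assumes "finite I" "\<And>i. i \<in> I \<Longrightarrow> F i differentiable at z"
  shows "wirt e k (\<lambda>x. \<Sum>i\<in>I. F i x) z = (\<Sum>i\<in>I. wirt e k (F i) z)"
  using assms by (induction I) (auto simp: wirt_add)

lemma differentiable_prod:
  fixes F :: "'i \<Rightarrow> 'x::real_normed_vector \<Rightarrow> 'b::{real_normed_field}"
  assumes "\<And>i. i \<in> I \<Longrightarrow> F i differentiable at z"
  shows "(\<lambda>x. \<Prod>i\<in>I. F i x) differentiable at z"
  using assms by (induction I rule: infinite_finite_induct) auto

lemma wirt_prod:
  assumes "finite I" "\<And>i. i \<in> I \<Longrightarrow> F i differentiable at z"
  shows "wirt e k (\<lambda>x. \<Prod>i\<in>I. F i x) z = (\<Sum>i\<in>I. wirt e k (F i) z * (\<Prod>j\<in>I-{i}. F j z))"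
  using assms
proof (induction I)
  case (insert i I)
  \<comment> \<open>Omitting an old index \<open>s\<close> keeps the new factor
    \<open>F i z\<close>, which can therefore be pulled out in front of the induction
    hypothesis.\<close>
  have "(\<Prod>j\<in>insert i I-{s}. F j z) = F i z * (\<Prod>j\<in>I-{s}. F j z)" if "s \<in> I" for s
  proof -
    have "insert i I-{s} = insert i (I - {s})" using that insert(2) by auto
    then show ?thesis using insert by simp
  qed
  then have "(\<Sum>s\<in>I. wirt e k (F s) z * (\<Prod>j\<in>insert i I-{s}. F j z))
      = F i z * (\<Sum>s\<in>I. wirt e k (F s) z * (\<Prod>j\<in>I-{s}. F j z))"
    by (simp add: sum_distrib_left mult_ac)
  then show ?case using insert by (simp add: wirt_mult differentiable_prod insert_Diff_if)
qed simp

text \<open>Conjugation is real linear and passes through the differential, but it conjugates the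
  coefficient \<open>e\<close>. For \<open>e = \<i>\<close> and \<open>e = - \<i>\<close> this
  exchanges the two Wirtinger operators.\<close>

lemma wirt_cnj:
  assumes "F differentiable at z"
  shows "wirt e k (\<lambda>x. cnj (F x)) z = cnj (wirt (cnj e) k F z)"
proof -
  obtain L where L: "(F has_derivative L) (at z)"
    using assms by (auto simp: differentiable_def)
  show ?thesis
    unfolding wirt_has_derivative[OF L] wirt_has_derivative[OF has_derivative_cnj[OF L]] by simp
qed

text \<open>The outer function is complex differentiable, so its differential is multiplication by
  \<open>D\<close> and no term with a conjugate arises. The lemma serves for \<open>inverse\<close>
  and \<open>ln\<close>.\<close>

lemma wirt_field_chain:
  assumes "(\<phi> has_field_derivative D) (at (F z))" "F differentiable at z"
  shows "wirt e k (\<lambda>x. \<phi> (F x)) z = D * wirt e k F z"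
proof -
  obtain L where L: "(F has_derivative L) (at z)"
    using assms by (auto simp: differentiable_def)
  have "((\<lambda>x. \<phi> (F x)) has_derivative (\<lambda>v. D * L v)) (at z)"
    using has_derivative_compose[OF L] assms(1) by (simp add: has_field_derivative_def)
  from wirt_has_derivative[OF this] show ?thesis
    unfolding wirt_has_derivative[OF L] by (simp add: field_simps)
qed

lemma differentiable_field_chain:
  assumes "(\<phi> has_field_derivative D) (at (F z))" "F differentiable at z"
  shows "(\<lambda>x. \<phi> (F x)) differentiable at z"
  using assms has_derivative_compose unfolding differentiable_def has_field_derivative_def by blast

text \<open>This is the decomposition of dF into its dz and conjugate dz parts: \<open>v\<close> is
  expanded in the real basis \<open>axis i 1\<close>, \<open>axis i \<i>\<close>, and real and
  imaginary parts are rewritten through \<open>v $ i\<close> and its conjugate.\<close>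

lemma has_derivative_wirtinger:
  fixes z :: "complex^'m::finite"
  assumes L: "(F has_derivative L) (at z)"
  shows "L v = (\<Sum>i\<in>UNIV. v $ i * pd i F z + cnj (v $ i) * pdbar i F z)"
proof -
  have lin: "linear L" using L by (rule has_derivative_linear)
  have "v = (\<Sum>i\<in>UNIV. Re (v $ i) *\<^sub>R axis i 1 + Im (v $ i) *\<^sub>R axis i \<i>)"
  unfolding Finite_Cartesian_Product.vec_eq_iff
  proof (rule allI)
    fix j
    have "(\<Sum>i\<in>UNIV. Re (v $ i) *\<^sub>R axis i 1 + Im (v $ i) *\<^sub>R axis i \<i>) $ j
      = (\<Sum>i\<in>UNIV. if j = i then v $ j else 0)"
      unfolding sum_component
      by (intro sum.cong refl) (auto simp: axis_def complex_eq_iff)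
    then show "v $ j = (\<Sum>i\<in>UNIV. Re (v $ i) *\<^sub>R axis i 1 + Im (v $ i) *\<^sub>R axis i \<i>) $ j"
      by simp
  qed
  then have "L v = L (\<Sum>i\<in>UNIV. Re (v $ i) *\<^sub>R axis i 1 + Im (v $ i) *\<^sub>R axis i \<i>)"
    by simp
  also have "\<dots> = (\<Sum>i\<in>UNIV. Re (v $ i) *\<^sub>R L (axis i 1) + Im (v $ i) *\<^sub>R L (axis i \<i>))"
    using lin by (simp add: linear_sum linear_add linear_scale)
  also have "\<dots> = (\<Sum>i\<in>UNIV. v $ i * pd i F z + cnj (v $ i) * pdbar i F z)"
  proof (rule sum.cong[OF refl])
    fix i
    have "v $ i * pd i F z + cnj (v $ i) * pdbar i F z =
       (v $ i + cnj (v $ i)) / 2 * L (axis i 1) - \<i> * (v $ i - cnj (v $ i)) / 2 * L (axis i \<i>)"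
      unfolding pd_wirt pdbar_wirt wirt_has_derivative[OF L] by (simp add: field_simps)
    also have "\<dots> = Re (v $ i) *\<^sub>R L (axis i 1) + Im (v $ i) *\<^sub>R L (axis i \<i>)"
      by (simp add: complex_add_cnj complex_diff_cnj scaleR_conv_of_real algebra_simps)
    finally show "Re (v $ i) *\<^sub>R L (axis i 1) + Im (v $ i) *\<^sub>R L (axis i \<i>) =
      v $ i * pd i F z + cnj (v $ i) * pdbar i F z" ..
  qed
  finally show ?thesis .
qed

lemma axis_smult: "axis k (c * x) = c *s (axis k x :: complex^'m)"
  by (auto simp: Finite_Cartesian_Product.vec_eq_iff axis_def)

text \<open>Complex linearity gives \<open>L (axis k \<i>) = \<i> *s L (axis k 1)\<close>. In the
  Wirtinger form of the differential of \<open>H\<close>, the conjugated terms then cancel for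
  \<open>pd\<close> and the unconjugated ones for \<open>pdbar\<close>.\<close>

lemma
  fixes F :: "complex^'m::finite \<Rightarrow> complex^'n::finite"
  assumes F: "(F has_derivative L) (at z)" and lin: "\<And>c v. L (c *s v) = c *s L v"
    and H: "H differentiable at (F z)"
  shows pd_chain: "pd k (\<lambda>x. H (F x)) z = (\<Sum>i\<in>UNIV. pd i H (F z) * pd k (\<lambda>x. F x $ i) z)"
    and pdbar_chain: "pdbar k (\<lambda>x. H (F x)) z = (\<Sum>i\<in>UNIV. pdbar i H (F z) * cnj (pd k (\<lambda>x. F x $ i) z))"
proof -
  obtain K where K: "(H has_derivative K) (at (F z))"
    using H by (auto simp: differentiable_def)
  have HF: "((\<lambda>x. H (F x)) has_derivative (\<lambda>v. K (L v))) (at z)"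
    using has_derivative_compose[OF F K] .
  have Li: "L (axis k \<i>) = \<i> *s L (axis k 1)"
    using lin[of \<i> "axis k 1"] by (simp flip: axis_smult)
  have comp: "((\<lambda>x. F x $ i) has_derivative (\<lambda>v. L v $ i)) (at z)" for i
    using bounded_linear.has_derivative[OF bounded_linear_vec_nth F] .
  have u: "pd k (\<lambda>x. F x $ i) z = L (axis k 1) $ i" for i
    unfolding pd_wirt wirt_has_derivative[OF comp] Li by simp
  have ii: "\<i> * (\<i> * x) = - x" for x :: complex
    by (simp flip: mult.assoc)
  show "pd k (\<lambda>x. H (F x)) z = (\<Sum>i\<in>UNIV. pd i H (F z) * pd k (\<lambda>x. F x $ i) z)"
    unfolding u
    unfolding pd_wirt[of k] wirt_has_derivative[OF HF] Li
    unfolding has_derivative_wirtinger[OF K] sum_distrib_left sum.distrib[symmetric] sum_divide_distrib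
    by (intro sum.cong refl) (simp add: field_simps ii)
  show "pdbar k (\<lambda>x. H (F x)) z = (\<Sum>i\<in>UNIV. pdbar i H (F z) * cnj (pd k (\<lambda>x. F x $ i) z))"
    unfolding u
    unfolding pdbar_wirt[of k] wirt_has_derivative[OF HF] Li
    unfolding has_derivative_wirtinger[OF K] sum_distrib_left sum.distrib[symmetric] sum_divide_distrib
    by (intro sum.cong refl) (simp add: field_simps ii)
qed

section \<open>Partial derivatives of holomorphic functions are holomorphic and commute\<close>

section \<open>Partial derivatives of holomorphic functions\<close>

text \<open>Scalar form of \<open>mholomorphic_on\<close>, suited to passing from a function to its
  partial derivatives repeatedly.\<close>

definition cholomorphic_on :: "(complex^'m::finite \<Rightarrow> complex) \<Rightarrow> (complex^'m) set \<Rightarrow> bool" where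
  "cholomorphic_on u S \<longleftrightarrow>
    (\<forall>z\<in>S. \<exists>L. (u has_derivative L) (at z) \<and> (\<forall>k v. L (k *s v) = k * L v))"

lemma cholomorphic_on_component:
  assumes "mholomorphic_on F S"
  shows "cholomorphic_on (\<lambda>x. F x $ i) S"
  unfolding cholomorphic_on_def
proof
  fix z assume "z \<in> S"
  with assms obtain L where L: "(F has_derivative L) (at z)" "\<And>k v. L (k *s v) = k *s L v"
    unfolding mholomorphic_on_def by blast
  have "((\<lambda>x. F x $ i) has_derivative (\<lambda>v. L v $ i)) (at z)"
    using bounded_linear.has_derivative[OF bounded_linear_vec_nth L(1)] .
  then show "\<exists>L. ((\<lambda>x. F x $ i) has_derivative L) (at z) \<and> (\<forall>k v. L (k *s v) = k * L v)"
    using L(2) by (intro exI[of _ "\<lambda>v. L v $ i"]) simp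
qed

text \<open>The Cauchy-Riemann equations: with a complex linear differential the directions
  \<open>axis k 1\<close> and \<open>axis k \<i>\<close> cancel in \<open>pdbar\<close>, and the
  Wirtinger form of the differential keeps only its \<open>pd\<close> terms.\<close>

lemma
  assumes "cholomorphic_on u S" "z \<in> S"
  shows cholomorphic_on_pdbar: "pdbar k u z = 0"
    and cholomorphic_on_has_derivative:
      "(u has_derivative (\<lambda>v. \<Sum>i\<in>UNIV. v $ i * pd i u z)) (at z)"
proof -
  from assms obtain L where L: "(u has_derivative L) (at z)" "\<And>k v. L (k *s v) = k * L v"
    unfolding cholomorphic_on_def by blast
  have "L (axis k \<i>) = \<i> * L (axis k 1)" for k
    using L(2)[of \<i> "axis k 1"] by (simp flip: axis_smult)
  then have 0: "pdbar k u z = 0" for k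
    by (simp add: pdbar_wirt wirt_has_derivative[OF L(1)])
  then show "pdbar k u z = 0" .
  have "L = (\<lambda>v. \<Sum>i\<in>UNIV. v $ i * pd i u z)"
    by (rule ext) (simp add: has_derivative_wirtinger[OF L(1)] 0)
  with L(1) show "(u has_derivative (\<lambda>v. \<Sum>i\<in>UNIV. v $ i * pd i u z)) (at z)"
    by simp
qed

lemma cholomorphic_on_differentiable:
  "cholomorphic_on u S \<Longrightarrow> z \<in> S \<Longrightarrow> u differentiable at z"
  using cholomorphic_on_has_derivative unfolding differentiable_def by blast

lemma cholomorphic_on_imp_continuous_on: "cholomorphic_on u S \<Longrightarrow> continuous_on S u"
  using cholomorphic_on_differentiable differentiable_imp_continuous_within
  by (blast intro: continuous_at_imp_continuous_on)

section \<open>Cauchy's formula along coordinate lines, with the centre as a parameter\<close>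

lemma norm_axis: "norm (axis k x :: complex^'m::finite) = cmod x"
proof -
  have "(\<Sum>i\<in>UNIV. (cmod (axis k x $ i))\<^sup>2) = (\<Sum>i\<in>UNIV. if i = k then (cmod x)\<^sup>2 else 0)"
    by (intro sum.cong refl) (simp add: axis_def)
  then show ?thesis by (simp add: norm_vec_def L2_set_def)
qed

lemma bounded_linear_axis: "bounded_linear (axis k :: complex \<Rightarrow> complex^'m::finite)"
proof (rule bounded_linear_intro[of _ 1])
  fix x y :: complex and r :: real
  show "axis k (x + y) = axis k x + (axis k y :: complex^'m)"
    by (auto simp: Finite_Cartesian_Product.vec_eq_iff axis_def)
  show "axis k (r *\<^sub>R x) = r *\<^sub>R (axis k x :: complex^'m)"
    by (auto simp: Finite_Cartesian_Product.vec_eq_iff axis_def)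
  show "norm (axis k x :: complex^'m) \<le> norm x * 1"
    by (simp add: norm_axis)
qed

text \<open>Restriction to a complex coordinate line, which is how one-variable Cauchy theory
  becomes applicable.\<close>

lemma cholomorphic_on_axis_has_field_derivative:
  assumes "cholomorphic_on u S" "w + axis k \<zeta> \<in> S"
  shows "((\<lambda>\<zeta>. u (w + axis k \<zeta>)) has_field_derivative pd k u (w + axis k \<zeta>)) (at \<zeta>)"
proof -
  have "((\<lambda>\<zeta>. w + axis k \<zeta>) has_derivative axis k) (at \<zeta>)"
    using has_derivative_add[OF has_derivative_const bounded_linear_imp_has_derivative[OF bounded_linear_axis]]
    by simp
  from has_derivative_compose[OF this cholomorphic_on_has_derivative[OF assms]]
  have "((\<lambda>\<zeta>. u (w + axis k \<zeta>)) has_derivative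
      (\<lambda>x. \<Sum>i\<in>UNIV. axis k x $ i * pd i u (w + axis k \<zeta>))) (at \<zeta>)" .
  moreover have "(\<Sum>i\<in>UNIV. axis k x $ i * pd i u (w + axis k \<zeta>)) = pd k u (w + axis k \<zeta>) * x" for x
  proof -
    have "(\<Sum>i\<in>UNIV. axis k x $ i * pd i u (w + axis k \<zeta>)) =
      (\<Sum>i\<in>UNIV. if i = k then x * pd i u (w + axis k \<zeta>) else 0)"
      by (intro sum.cong refl) (simp add: axis_def)
    then show ?thesis by simp
  qed
  ultimately show ?thesis
    by (simp add: has_field_derivative_def)
qed

text \<open>The parametrisation of the circle of radius \<open>r\<close> about 0 over the unit
  interval that agrees with \<open>circlepath 0 r\<close>.\<close>

definition circ :: "real \<Rightarrow> real \<Rightarrow> complex" where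
  "circ r t = of_real r * exp (2 * of_real pi * \<i> * of_real t)"

lemma norm_circ: "r > 0 \<Longrightarrow> cmod (circ r t) = r"
  by (simp add: circ_def norm_mult)

lemma circ_nonzero: "r > 0 \<Longrightarrow> circ r t \<noteq> 0"
  by (simp add: circ_def)

lemma continuous_on_circ [continuous_intros]:
  "continuous_on A h \<Longrightarrow> continuous_on A (\<lambda>x. circ r (h x))"
  unfolding circ_def by (intro continuous_intros)

text \<open>Cauchy's formula for the first derivative of the restriction to a coordinate line. The
  kernel \<open>1 / \<zeta>^2\<close> times the velocity \<open>2 pi \<i> \<zeta>\<close> of the
  circle leaves one factor \<open>1 / \<zeta>\<close>, and \<open>2 pi \<i>\<close> cancels the
  constant in front.\<close>

lemma pd_Cauchy_integral:
  assumes u: "cholomorphic_on u S" and r: "r > 0"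
    and S: "\<And>\<zeta>. cmod \<zeta> \<le> r \<Longrightarrow> w + axis k \<zeta> \<in> S"
  shows "pd k u w = integral {0..1} (\<lambda>t. u (w + axis k (circ r t)) / circ r t)"
proof -
  define \<phi> where "\<phi> = (\<lambda>\<zeta>. u (w + axis k \<zeta>))"
  have D: "(\<phi> has_field_derivative pd k u (w + axis k \<zeta>)) (at \<zeta>)" if "cmod \<zeta> \<le> r" for \<zeta>
    unfolding \<phi>_def by (rule cholomorphic_on_axis_has_field_derivative[OF u S[OF that]])
  have hol: "\<phi> holomorphic_on ball 0 r"
    unfolding holomorphic_on_open[OF open_ball]
  proof
    fix x :: complex assume "x \<in> ball 0 r"
    then have "cmod x \<le> r" by simp
    from D[OF this] show "\<exists>f'. (\<phi> has_field_derivative f') (at x)" ..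
  qed
  have cont: "continuous_on (cball 0 r) \<phi>"
    using D DERIV_isCont by (fastforce intro!: continuous_at_imp_continuous_on)
  have "pd k u (w + axis k 0) =
      1 / (2 * of_real pi * \<i>) * contour_integral (circlepath 0 r) (\<lambda>u. \<phi> u / (u - 0)\<^sup>2)"
    \<comment> \<open>The derivative at the centre supplied by Cauchy's formula is identified with
      \<open>pd k u\<close> by uniqueness of derivatives.\<close>
    using Cauchy_derivative_integral_circlepath(2)[OF cont hol, of 0] r D[of 0]
    by (auto intro: DERIV_unique)
  also have "contour_integral (circlepath 0 r) (\<lambda>u. \<phi> u / (u - 0)\<^sup>2) =
      integral {0..1} (\<lambda>t. (2 * of_real pi * \<i>) * (\<phi> (circ r t) / circ r t))"
    unfolding contour_integral_integral
  proof (rule integral_cong)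
    fix t :: real
    show "\<phi> (circlepath 0 r t) / (circlepath 0 r t - 0)\<^sup>2 * vector_derivative (circlepath 0 r) (at t)
       = (2 * of_real pi * \<i>) * (\<phi> (circ r t) / circ r t)"
      unfolding vector_derivative_circlepath
      using r by (simp add: circlepath circ_def power2_eq_square field_simps)
  qed
  also have "\<dots> = (2 * of_real pi * \<i>) * integral {0..1} (\<lambda>t. \<phi> (circ r t) / circ r t)"
    by (rule integral_mult_right)
  finally have "pd k u (w + axis k 0) = integral {0..1} (\<lambda>t. \<phi> (circ r t) / circ r t)"
    by simp
  moreover have "axis k 0 = (0 :: complex^'a)"
    by (simp add: Finite_Cartesian_Product.vec_eq_iff axis_def)
  ultimately show ?thesis by (simp add: \<phi>_def)
qed

text \<open>Half the radius of a ball inside \<open>S\<close> is spent on moving the centre and half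
  on the circle, so one radius works for all centres near \<open>z\<close>.\<close>

lemma open_axis_radius:
  assumes "open S" "(z::complex^'m::finite) \<in> S"
  obtains r where "r > 0" "\<And>w k \<zeta>. w \<in> ball z r \<Longrightarrow> cmod \<zeta> \<le> r \<Longrightarrow> w + axis k \<zeta> \<in> S"
proof -
  obtain e where e: "e > 0" "ball z e \<subseteq> S" using assms by (meson openE)
  have "w + axis k \<zeta> \<in> S" if "w \<in> ball z (e / 2)" "cmod \<zeta> \<le> e / 2" for w k \<zeta>
  proof -
    have "dist z (w + axis k \<zeta>) \<le> dist z w + norm (axis k \<zeta> :: complex^'m)"
      by (metis dist_triangle_le dist_norm add_diff_cancel_left' dist_commute order.refl)
    with that have "w + axis k \<zeta> \<in> ball z e" by (simp add: norm_axis)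
    with e show ?thesis by blast
  qed
  with e(1) that[of "e / 2"] show ?thesis by simp
qed

text \<open>Joint continuity in centre and circle parameter, the hypothesis of the theorems on
  parameter integrals. It is stated for any continuous \<open>u\<close> so that it also applies to
  partial derivatives.\<close>

lemma continuous_on_circ_integrand:
  assumes u: "continuous_on S u" and r: "r > 0"
    and S: "\<And>w \<zeta>. w \<in> B \<Longrightarrow> cmod \<zeta> \<le> r \<Longrightarrow> w + axis k \<zeta> \<in> S"
  shows "continuous_on (B \<times> cbox 0 1) (\<lambda>(w, t). u (w + axis k (circ r t)) / circ r t)"
proof -
  have "continuous_on (B \<times> cbox 0 1) (\<lambda>x. u (fst x + axis k (circ r (snd x))))"
    by (rule continuous_on_compose2[OF u])
      (auto intro!: continuous_intros bounded_linear.continuous_on[OF bounded_linear_axis] S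
         simp: norm_circ[OF r])
  then show ?thesis
    unfolding split_beta using r by (auto intro!: continuous_intros simp: circ_nonzero)
qed

text \<open>Holomorphy is defined by pointwise differentiability only. Cauchy's formula expresses
  \<open>pd k u\<close> through the values of \<open>u\<close>, and a parameter integral with
  jointly continuous integrand is continuous.\<close>

lemma continuous_on_pd:
  assumes S: "open S" and u: "cholomorphic_on u S"
  shows "continuous_on S (pd k u)"
proof (rule continuous_at_imp_continuous_on, rule ballI)
  fix z assume "z \<in> S"
  then obtain r where r: "r > 0" "\<And>w k \<zeta>. w \<in> ball z r \<Longrightarrow> cmod \<zeta> \<le> r \<Longrightarrow> w + axis k \<zeta> \<in> S"
    using open_axis_radius[OF S] by metis
  have "continuous_on (ball z r) (\<lambda>w. integral (cbox 0 1) (\<lambda>t. u (w + axis k (circ r t)) / circ r t))"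
    by (rule integral_continuous_on_param
        continuous_on_circ_integrand[OF cholomorphic_on_imp_continuous_on[OF u] r(1) r(2)])+
  then have "continuous_on (ball z r) (pd k u)"
    by (rule continuous_on_eq) (use pd_Cauchy_integral[OF u r(1) r(2)] in simp)
  with r(1) show "isCont (pd k u) z"
    by (simp add: continuous_on_eq_continuous_at)
qed

text \<open>Differentiation under the integral sign in Cauchy's formula; the partial derivatives of \<open>u\<close>
  are already known to be continuous, by the same formula.\<close>

lemma pd_has_derivative_integral:
  fixes z :: "complex^'m::finite"
  assumes S: "open S" and u: "cholomorphic_on u S" and r: "r > 0"
    and ball: "\<And>w \<zeta>. w \<in> ball z r \<Longrightarrow> cmod \<zeta> \<le> r \<Longrightarrow> w + axis k \<zeta> \<in> S"
  shows "(pd k u has_derivative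
    (\<lambda>v. integral {0..1} (\<lambda>t. (\<Sum>i\<in>UNIV. v $ i * pd i u (z + axis k (circ r t))) / circ r t))) (at z)"
proof -
  \<comment> \<open>The differential of the Cauchy integrand with respect to the centre
    \<open>w\<close>, at circle parameter \<open>t\<close>.\<close>
  define D where "D = (\<lambda>w t v. (\<Sum>i\<in>UNIV. v $ i * pd i u (w + axis k (circ r t))) / circ r t)"
  have deriv: "((\<lambda>w. u (w + axis k (circ r t)) / circ r t) has_derivative D w t) (at w)"
    if "w \<in> ball z r" for w t
  proof -
    have "w + axis k (circ r t) \<in> S"
      using ball[OF that, of "circ r t"] norm_circ[OF r] by simp
    from cholomorphic_on_has_derivative[OF u this]
    have "((\<lambda>w. u (w + axis k (circ r t))) has_derivative
        (\<lambda>v. \<Sum>i\<in>UNIV. v $ i * pd i u (w + axis k (circ r t)))) (at w)"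
      using has_derivative_compose[OF has_derivative_add[OF has_derivative_ident has_derivative_const]]
      by fastforce
    then show ?thesis
      unfolding D_def divide_inverse by (rule has_derivative_mult_left)
  qed
  then have bl: "bounded_linear (D w t)" if "w \<in> ball z r" for w t
    using that has_derivative_bounded_linear by blast
  have contD: "continuous_on (ball z r \<times> cbox 0 1) (\<lambda>(w, t). D w t v)" for v
  proof -
    have "continuous_on (ball z r \<times> cbox 0 1)
        (\<lambda>x. \<Sum>i\<in>UNIV. v $ i * (case x of (w, t) \<Rightarrow> pd i u (w + axis k (circ r t)) / circ r t))"
      by (intro continuous_intros continuous_on_circ_integrand[OF continuous_on_pd[OF S u] r ball])
    then show ?thesis
      by (simp add: D_def split_beta sum_divide_distrib)
  qed
  have "((\<lambda>w. integral (cbox 0 1) (\<lambda>t. u (w + axis k (circ r t)) / circ r t)) has_derivative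
      integral (cbox 0 1) (\<lambda>t. Blinfun (D z t))) (at z within ball z r)"
  proof (rule leibniz_rule)
    fix w t assume w: "w \<in> ball z r"
    show "((\<lambda>w. u (w + axis k (circ r t)) / circ r t) has_derivative Blinfun (D w t)) (at w within ball z r)"
      using deriv[OF w] bl[OF w] by (simp add: bounded_linear_Blinfun_apply has_derivative_at_withinI)
  next
    have *: "continuous_on (ball z r \<times> cbox 0 1) (\<lambda>(w, t). u (w + axis k (circ r t)) / circ r t)"
      by (rule continuous_on_circ_integrand[OF cholomorphic_on_imp_continuous_on[OF u] r ball])
    fix w assume w: "w \<in> ball z r"
    have "continuous_on (cbox 0 1) (\<lambda>t. case (w, t) of (w, t) \<Rightarrow> u (w + axis k (circ r t)) / circ r t)"
      by (rule continuous_on_compose2[OF *]) (use w in \<open>auto intro!: continuous_intros\<close>)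
    then show "(\<lambda>t. u (w + axis k (circ r t)) / circ r t) integrable_on cbox 0 1"
      unfolding case_prod_conv by (rule integrable_continuous)
  next
    show "continuous_on (ball z r \<times> cbox 0 1) (\<lambda>(w, t). Blinfun (D w t))"
    \<comment> \<open>The Leibniz rule asks for continuity in operator norm; in finite dimension it
      is enough to test it on each fixed vector \<open>v\<close>.\<close>
    proof (rule continuous_on_blinfun_componentwise)
      fix v :: "complex^'m"
      have "(case x of (w, t) \<Rightarrow> D w t v) = (case x of (w, t) \<Rightarrow> Blinfun (D w t)) v"
        if "x \<in> ball z r \<times> cbox 0 1" for x
        using that bl by (auto simp: bounded_linear_Blinfun_apply)
      with contD[of v] show "continuous_on (ball z r \<times> cbox 0 1)
          (\<lambda>x. blinfun_apply (case x of (w, t) \<Rightarrow> Blinfun (D w t)) v)"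
        by (rule continuous_on_eq)
    qed
  qed (use r in simp_all)
  moreover have "at z within ball z r = at z"
    using r by (simp add: at_within_open[OF _ open_ball])
  moreover have "blinfun_apply (integral (cbox 0 1) (\<lambda>t. Blinfun (D z t))) v = integral {0..1} (\<lambda>t. D z t v)" for v
  proof -
    have z: "z \<in> ball z r" using r by simp
    have "continuous_on (cbox 0 1) (\<lambda>t. Blinfun (D z t))"
    proof (rule continuous_on_blinfun_componentwise)
      fix v :: "complex^'m"
      have "continuous_on (cbox 0 1) (\<lambda>t. case (z, t) of (w, t) \<Rightarrow> D w t v)"
        by (rule continuous_on_compose2[OF contD[of v]]) (use z in \<open>auto intro!: continuous_intros\<close>)
      then show "continuous_on (cbox 0 1) (\<lambda>t. blinfun_apply (Blinfun (D z t)) v)"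
        by (simp add: bounded_linear_Blinfun_apply[OF bl[OF z]])
    qed
    then have "(\<lambda>t. Blinfun (D z t)) integrable_on cbox 0 1"
      by (rule integrable_continuous)
    \<comment> \<open>Evaluation at \<open>v\<close> is a bounded linear map on operators, so it may
      be moved inside the integral.\<close>
    from integral_linear[OF this blinfun.bounded_linear_left[of v]]
    show ?thesis
      by (simp add: o_def bounded_linear_Blinfun_apply[OF bl[OF z]] cbox_interval)
  qed
  then have "blinfun_apply (integral (cbox 0 1) (\<lambda>t. Blinfun (D z t))) = (\<lambda>v. integral {0..1} (\<lambda>t. D z t v))"
    by (rule ext)
  ultimately have *: "((\<lambda>w. integral {0..1} (\<lambda>t. u (w + axis k (circ r t)) / circ r t)) has_derivative
      (\<lambda>v. integral {0..1} (\<lambda>t. D z t v))) (at z)"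
    by (simp add: cbox_interval)
  then have "(pd k u has_derivative (\<lambda>v. integral {0..1} (\<lambda>t. D z t v))) (at z)"
    by (rule has_derivative_transform_within_open[OF _ open_ball[of z r]])
      (use r pd_Cauchy_integral[OF u r ball] in auto)
  then show ?thesis by (simp add: D_def)
qed

text \<open>The differential found under the integral sign is an integral of complex linear maps,
  hence complex linear. Iteration gives the higher derivatives of a holomorphic map that the formula
  requires.\<close>

theorem cholomorphic_on_pd:
  fixes S :: "(complex^'m::finite) set"
  assumes S: "open S" and u: "cholomorphic_on u S"
  shows "cholomorphic_on (pd k u) S"
  unfolding cholomorphic_on_def
proof
  fix z assume "z \<in> S"
  then obtain r where r: "r > 0" "\<And>w k \<zeta>. w \<in> ball z r \<Longrightarrow> cmod \<zeta> \<le> r \<Longrightarrow> w + axis k \<zeta> \<in> S"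
    using open_axis_radius[OF S] by metis
  define L where "L = (\<lambda>v. integral {0..1}
      (\<lambda>t. (\<Sum>i\<in>UNIV. v $ i * pd i u (z + axis k (circ r t))) / circ r t))"
  have "L (c *s v) = c * L v" for c v
    unfolding L_def integral_mult_right[symmetric]
    by (simp add: sum_distrib_left mult.assoc)
  moreover have "(pd k u has_derivative L) (at z)"
    unfolding L_def by (rule pd_has_derivative_integral[OF S u r])
  ultimately show "\<exists>L. (pd k u has_derivative L) (at z) \<and> (\<forall>c v. L (c *s v) = c * L v)"
    by blast
qed

text \<open>Differentiating Cauchy's integral for \<open>pd k u\<close> in direction
  \<open>i\<close>, and writing Cauchy's formula for the holomorphic function \<open>pd i u\<close>
  in direction \<open>k\<close>, lead to the same integral.\<close>

lemma pd_commute: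
  fixes S :: "(complex^'m::finite) set"
  assumes S: "open S" and u: "cholomorphic_on u S" and z: "z \<in> S"
  shows "pd i (pd k u) z = pd k (pd i u) z"
proof -
  obtain r where r: "r > 0" "\<And>w k \<zeta>. w \<in> ball z r \<Longrightarrow> cmod \<zeta> \<le> r \<Longrightarrow> w + axis k \<zeta> \<in> S"
    using open_axis_radius[OF S z] by metis
  have ax: "(\<Sum>j\<in>UNIV. axis i x $ j * pd j u w) = x * pd i u w" for x w
  proof -
    have "(\<Sum>j\<in>UNIV. axis i x $ j * pd j u w) = (\<Sum>j\<in>UNIV. if j = i then x * pd j u w else 0)"
      by (intro sum.cong refl) (simp add: axis_def)
    then show ?thesis by simp
  qed
  have "pd i (pd k u) z = integral {0..1} (\<lambda>t. pd i u (z + axis k (circ r t)) / circ r t)"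
  proof -
    have D: "(pd k u has_derivative
      (\<lambda>v. integral {0..1} (\<lambda>t. (\<Sum>i\<in>UNIV. v $ i * pd i u (z + axis k (circ r t))) / circ r t))) (at z)"
      by (rule pd_has_derivative_integral[OF S u r])
    have "pd i (pd k u) z = wirt (- \<i>) i (pd k u) z"
      by (simp add: pd_wirt)
    also have "\<dots> = (integral {0..1} (\<lambda>t. 1 * pd i u (z + axis k (circ r t)) / circ r t) +
        - \<i> * integral {0..1} (\<lambda>t. \<i> * pd i u (z + axis k (circ r t)) / circ r t)) / 2"
      unfolding wirt_has_derivative[OF D] ax ..
    \<comment> \<open>The directions \<open>axis i 1\<close> and \<open>axis i \<i>\<close> give the
      same integral with factors 1 and \<open>\<i>\<close>; since \<open>- \<i> * \<i> = 1\<close>,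
      their half-sum is that integral.\<close>
    also have "\<dots> = integral {0..1} (\<lambda>t. pd i u (z + axis k (circ r t)) / circ r t)"
      unfolding times_divide_eq_right[symmetric] integral_mult_right by (simp flip: mult.assoc)
    finally show ?thesis .
  qed
  also have "\<dots> = pd k (pd i u) z"
    using pd_Cauchy_integral[OF cholomorphic_on_pd[OF S u] r(1), of z] r by simp
  finally show ?thesis .
qed

section \<open>Second derivatives of logarithms of quotients and of determinants\<close>

section \<open>Logarithms of determinants\<close>

lemma wirt_diff:
  assumes "F differentiable at z" "G differentiable at z"
  shows "wirt e k (\<lambda>x. F x - G x) z = wirt e k F z - wirt e k G z"
proof -
  have "wirt e k (\<lambda>x. F x + - 1 * G x) z = wirt e k F z - wirt e k G z"
    using wirt_add[OF assms(1) differentiable_mult[OF differentiable_const assms(2)], of e k "-1"]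
    unfolding wirt_cmult[OF assms(2)] by simp
  then show ?thesis by simp
qed

lemma
  assumes "F differentiable at z" "F z \<noteq> 0"
  shows wirt_inverse: "wirt e k (\<lambda>x. inverse (F x)) z = - wirt e k F z / (F z)\<^sup>2"
    and differentiable_inverse_complex: "(\<lambda>x. inverse (F x)) differentiable at z"
proof -
  have D: "(inverse has_field_derivative - (inverse (F z) ^ Suc (Suc 0))) (at (F z))"
    by (rule DERIV_inverse[OF assms(2)])
  show "wirt e k (\<lambda>x. inverse (F x)) z = - wirt e k F z / (F z)\<^sup>2"
    unfolding wirt_field_chain[OF D assms(1)] by (simp add: divide_inverse power2_eq_square)
  show "(\<lambda>x. inverse (F x)) differentiable at z"
    by (rule differentiable_field_chain[OF D assms(1)])
qed

text \<open>Away from the branch cut, the first derivative of the logarithm is the difference of the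
  logarithmic derivatives of \<open>P\<close> and \<open>Q\<close>. Only the quotient has to avoid
  the cut, since no separate logarithm of \<open>P\<close> or \<open>Q\<close> is taken.\<close>

lemma wirt_wirt_ln_quotient:
  assumes S: "open S" "z \<in> S"
    and P: "\<And>x. x \<in> S \<Longrightarrow> P differentiable at x" "wirt e k P differentiable at z"
    and Q: "\<And>x. x \<in> S \<Longrightarrow> Q differentiable at x" "wirt e k Q differentiable at z"
    and nz: "Q z \<noteq> 0" "P z / Q z \<notin> \<real>\<^sub>\<le>\<^sub>0"
  shows "wirt e' k' (wirt e k (\<lambda>x. ln (P x / Q x))) z =
    (wirt e' k' (wirt e k P) z / P z - wirt e k P z * wirt e' k' P z / (P z)\<^sup>2) -
    (wirt e' k' (wirt e k Q) z / Q z - wirt e k Q z * wirt e' k' Q z / (Q z)\<^sup>2)"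
proof -
  have cP: "continuous_on S P" and cQ: "continuous_on S Q"
    using P(1) Q(1) differentiable_imp_continuous_within by (blast intro: continuous_at_imp_continuous_on)+
  \<comment> \<open>Nonvanishing of \<open>Q\<close> comes first, as it makes the quotient
    continuous; then the branch cut is removed. The result is an open set on which the first
    derivative has a closed form that can be differentiated again.\<close>
  define S' where "S' = S \<inter> Q -` (- {0})"
  have S': "open S'"
    unfolding S'_def by (rule continuous_open_preimage[OF cQ S(1)]) (simp add: open_Compl)
  define T where "T = S' \<inter> (\<lambda>x. P x / Q x) -` (- \<real>\<^sub>\<le>\<^sub>0)"
  have "continuous_on S' (\<lambda>x. P x / Q x)"
    using cP cQ by (auto simp: S'_def intro!: continuous_intros intro: continuous_on_subset)
  then have T: "open T"
    unfolding T_def by (rule continuous_open_preimage[OF _ S']) (simp add: closed_nonpos_Reals_complex open_Compl)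
  have zT: "z \<in> T" using S nz by (simp add: T_def S'_def)
  have ln': "wirt e k (\<lambda>x. ln (P x / Q x)) x = wirt e k P x * inverse (P x) - wirt e k Q x * inverse (Q x)"
    if "x \<in> T" for x
  proof -
    \<comment> \<open>\<open>P x\<close> is nonzero because 0 belongs to the removed
      half-line.\<close>
    have x: "P differentiable at x" "Q differentiable at x" "Q x \<noteq> 0" "P x * inverse (Q x) \<notin> \<real>\<^sub>\<le>\<^sub>0" "P x \<noteq> 0"
      using that P(1) Q(1) by (auto simp: T_def S'_def divide_inverse)
    have "wirt e k (\<lambda>x. ln (P x * inverse (Q x))) x =
        inverse (P x * inverse (Q x)) * wirt e k (\<lambda>x. P x * inverse (Q x)) x"
      using has_field_derivative_Ln[OF x(4)] x
      by (intro wirt_field_chain) (auto intro!: differentiable_mult differentiable_inverse_complex)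
    also have "wirt e k (\<lambda>x. P x * inverse (Q x)) x =
        wirt e k P x * inverse (Q x) - P x * wirt e k Q x / (Q x)\<^sup>2"
      using x by (simp add: wirt_mult wirt_inverse differentiable_inverse_complex)
    also have "inverse (P x * inverse (Q x)) * \<dots> = wirt e k P x * inverse (P x) - wirt e k Q x * inverse (Q x)"
      using x by (simp add: field_simps power2_eq_square)
    finally show ?thesis by (simp add: divide_inverse)
  qed
  have z: "P differentiable at z" "Q differentiable at z" "P z \<noteq> 0" "Q z \<noteq> 0"
    using S nz P(1) Q(1) by auto
  have "wirt e' k' (wirt e k (\<lambda>x. ln (P x / Q x))) z =
      wirt e' k' (\<lambda>x. wirt e k P x * inverse (P x) - wirt e k Q x * inverse (Q x)) z"
    by (rule wirt_cong[OF T zT ln'])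
  also have "\<dots> = wirt e' k' (\<lambda>x. wirt e k P x * inverse (P x)) z - wirt e' k' (\<lambda>x. wirt e k Q x * inverse (Q x)) z"
    using P(2) Q(2) z by (intro wirt_diff differentiable_mult differentiable_inverse_complex) auto
  also have "\<dots> = (wirt e' k' (wirt e k P) z / P z - wirt e k P z * wirt e' k' P z / (P z)\<^sup>2) -
    (wirt e' k' (wirt e k Q) z / Q z - wirt e k Q z * wirt e' k' Q z / (Q z)\<^sup>2)"
    using P(2) Q(2) z
    by (simp add: wirt_mult[where F = "wirt e k P"] wirt_mult[where F = "wirt e k Q"] wirt_inverse
        differentiable_inverse_complex divide_inverse)
  finally show ?thesis .
qed

section \<open>Permutation sums at a diagonal matrix\<close>

text \<open>A permutation of \<open>N\<close> that fixes \<open>K\<close> pointwise permutes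
  \<open>N - K\<close>. Otherwise some point of \<open>K\<close> is moved, and its factor is
  zero.\<close>

lemma prod_fixed_points_eq_0:
  fixes d :: "'i \<Rightarrow> 'b::comm_ring_1"
  assumes "finite N" "K \<subseteq> N" "\<sigma> permutes N" "\<not> \<sigma> permutes (N - K)"
  shows "(\<Prod>j\<in>K. if j = \<sigma> j then d j else 0) = 0"
proof -
  have "\<exists>j\<in>K. \<sigma> j \<noteq> j"
    using permutes_superset[OF assms(3), of "N - K"] assms(2,4) by blast
  then obtain j where "j \<in> K" "\<sigma> j \<noteq> j" by blast
  then have "\<exists>j\<in>K. (if j = \<sigma> j then d j else 0) = 0"
    by (intro bexI[of _ j]) auto
  then show ?thesis
    using finite_subset[OF assms(2,1)] by (intro prod_zero)
qed

text \<open>\<open>K\<close> is the set of rows left undifferentiated, where the matrix is diagonal,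
  so only permutations of \<open>N - K\<close> survive. Its use with zero, one or two remaining rows
  gives the determinant and its first two derivatives.\<close>

lemma sum_permutations_fixed_points:
  fixes d :: "'i \<Rightarrow> 'b::comm_ring_1"
  assumes "finite N" "K \<subseteq> N"
  shows "(\<Sum>\<sigma> | \<sigma> permutes N. of_int (sign \<sigma>) * (a \<sigma> * (\<Prod>j\<in>K. if j = \<sigma> j then d j else 0)))
    = (\<Sum>\<sigma> | \<sigma> permutes (N - K). of_int (sign \<sigma>) * a \<sigma>) * (\<Prod>j\<in>K. d j)"
proof -
  have "(\<Sum>\<sigma> | \<sigma> permutes N. of_int (sign \<sigma>) * (a \<sigma> * (\<Prod>j\<in>K. if j = \<sigma> j then d j else 0)))
    = (\<Sum>\<sigma> | \<sigma> permutes (N - K). of_int (sign \<sigma>) * (a \<sigma> * (\<Prod>j\<in>K. if j = \<sigma> j then d j else 0)))"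
    using assms by (intro sum.mono_neutral_right)
      (auto simp: finite_permutations prod_fixed_points_eq_0 intro: permutes_subset)
  also have "\<dots> = (\<Sum>\<sigma> | \<sigma> permutes (N - K). of_int (sign \<sigma>) * a \<sigma> * (\<Prod>j\<in>K. d j))"
  proof (rule sum.cong[OF refl])
    fix \<sigma> assume "\<sigma> \<in> {\<sigma>. \<sigma> permutes (N - K)}"
    then have "(\<Prod>j\<in>K. if j = \<sigma> j then d j else 0) = (\<Prod>j\<in>K. d j)"
      by (intro prod.cong) (auto simp: permutes_def)
    then show "of_int (sign \<sigma>) * (a \<sigma> * (\<Prod>j\<in>K. if j = \<sigma> j then d j else 0)) =
        of_int (sign \<sigma>) * a \<sigma> * (\<Prod>j\<in>K. d j)"
      by (simp add: mult.assoc)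
  qed
  finally show ?thesis by (simp add: sum_distrib_right)
qed

text \<open>At a point where \<open>M\<close> is diagonal, only the identity and the transpositions contribute to the
  second derivative of the Leibniz formula.\<close>

lemma
  fixes d :: "'i \<Rightarrow> complex" and M :: "'i \<Rightarrow> 'i \<Rightarrow> complex^'m::finite \<Rightarrow> complex"
  assumes S: "open S" "z \<in> S" and N: "finite N"
    and M: "\<And>i j x. i \<in> N \<Longrightarrow> j \<in> N \<Longrightarrow> x \<in> S \<Longrightarrow> M i j differentiable at x"
    and M2: "\<And>i j. i \<in> N \<Longrightarrow> j \<in> N \<Longrightarrow> wirt e k (M i j) differentiable at z"
    and diag: "\<And>i j. i \<in> N \<Longrightarrow> j \<in> N \<Longrightarrow> M i j z = (if i = j then d i else 0)"
  defines "\<Delta> \<equiv> \<lambda>x. \<Sum>\<sigma> | \<sigma> permutes N. of_int (sign \<sigma>) * (\<Prod>i\<in>N. M i (\<sigma> i) x)"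
  shows leibniz_det_differentiable: "x \<in> S \<Longrightarrow> \<Delta> differentiable at x"
    and wirt_leibniz_det_differentiable: "wirt e k \<Delta> differentiable at z"
    and leibniz_det_diagonal: "\<Delta> z = (\<Prod>i\<in>N. d i)"
    and wirt_wirt_ln_leibniz_det: "(\<And>i. i \<in> N \<Longrightarrow> d i \<noteq> 0) \<Longrightarrow>
      wirt e' k' (wirt e k \<Delta>) z / \<Delta> z - wirt e k \<Delta> z * wirt e' k' \<Delta> z / (\<Delta> z)\<^sup>2 =
      (\<Sum>i\<in>N. wirt e' k' (wirt e k (M i i)) z / d i) -
      (\<Sum>i\<in>N. \<Sum>j\<in>N. wirt e k (M i j) z * wirt e' k' (M j i) z / (d i * d j))"
proof -
  have perm: "\<sigma> i \<in> N" if "\<sigma> permutes N" "i \<in> N" for \<sigma> i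
    using that by (simp add: permutes_in_image)
  have M': "M i (\<sigma> i) differentiable at x" if "\<sigma> permutes N" "i \<in> N" "x \<in> S" for \<sigma> i x
    by (rule M[OF that(2) perm[OF that(1,2)] that(3)])
  have M2': "wirt e k (M i (\<sigma> i)) differentiable at z" if "\<sigma> permutes N" "i \<in> N" for \<sigma> i
    by (rule M2[OF that(2) perm[OF that(1,2)]])
  have fin: "finite {\<sigma>. \<sigma> permutes N}" by (rule finite_permutations[OF N])
  show diff: "\<Delta> differentiable at x" if "x \<in> S" for x
    unfolding \<Delta>_def using that fin
    by (auto intro!: differentiable_sum differentiable_mult differentiable_prod M')
  have W: "wirt e k \<Delta> x = (\<Sum>\<sigma> | \<sigma> permutes N. of_int (sign \<sigma>) *
      (\<Sum>i\<in>N. wirt e k (M i (\<sigma> i)) x * (\<Prod>j\<in>N-{i}. M j (\<sigma> j) x)))" if "x \<in> S" for x e k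
  proof -
    have "wirt e k \<Delta> x = (\<Sum>\<sigma> | \<sigma> permutes N. wirt e k (\<lambda>x. of_int (sign \<sigma>) * (\<Prod>i\<in>N. M i (\<sigma> i) x)) x)"
      unfolding \<Delta>_def using that fin
      by (intro wirt_sum) (auto intro!: differentiable_mult differentiable_prod M')
    also have "\<dots> = (\<Sum>\<sigma> | \<sigma> permutes N. of_int (sign \<sigma>) * wirt e k (\<lambda>x. \<Prod>i\<in>N. M i (\<sigma> i) x) x)"
      using that by (intro sum.cong refl wirt_cmult differentiable_prod M') auto
    also have "\<dots> = (\<Sum>\<sigma> | \<sigma> permutes N. of_int (sign \<sigma>) *
      (\<Sum>i\<in>N. wirt e k (M i (\<sigma> i)) x * (\<Prod>j\<in>N-{i}. M j (\<sigma> j) x)))"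
      using that N by (intro sum.cong refl arg_cong2[of _ _ _ _ "(*)"] wirt_prod M') auto
    finally show ?thesis .
  qed
  \<comment> \<open>The closed form equals the derivative of the determinant only on
    \<open>S\<close>, so differentiability at \<open>z\<close> is proved for \<open>W'\<close> and
    then transferred.\<close>
  define W' where "W' = (\<lambda>x. \<Sum>\<sigma> | \<sigma> permutes N. of_int (sign \<sigma>) *
      (\<Sum>i\<in>N. wirt e k (M i (\<sigma> i)) x * (\<Prod>j\<in>N-{i}. M j (\<sigma> j) x)))"
  have WW': "wirt e k \<Delta> x = W' x" if "x \<in> S" for x
    unfolding W'_def by (rule W[OF that])
  have W'diff: "W' differentiable at z"
    unfolding W'_def using S(2) fin N
    by (auto intro!: differentiable_sum differentiable_mult differentiable_prod M' M2')
  then obtain L where "(W' has_derivative L) (at z)" unfolding differentiable_def by blast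
  then have "(wirt e k \<Delta> has_derivative L) (at z)"
    by (rule has_derivative_transform_within_open[OF _ S]) (simp add: WW')
  then show "wirt e k \<Delta> differentiable at z" unfolding differentiable_def by blast
  have prod0: "(\<Prod>j\<in>K. M j (\<sigma> j) z) = (\<Prod>j\<in>K. if j = \<sigma> j then d j else 0)"
    if "\<sigma> permutes N" "K \<subseteq> N" for \<sigma> K
    using that by (intro prod.cong refl) (auto simp: diag perm subset_iff)
  have "\<Delta> z = (\<Sum>\<sigma> | \<sigma> permutes N. of_int (sign \<sigma>) * (1 * (\<Prod>j\<in>N. if j = \<sigma> j then d j else 0)))"
    unfolding \<Delta>_def by (intro sum.cong refl) (simp add: prod0)
  also have "\<dots> = (\<Prod>i\<in>N. d i)"
    by (subst sum_permutations_fixed_points[OF N]) auto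
  finally show \<Delta>z: "\<Delta> z = (\<Prod>i\<in>N. d i)" .
  \<comment> \<open>Only row \<open>i\<close> is free, which leaves the identity; \<open>a\<close>
    stands for the differentiated row as a function of its column.\<close>
  have one: "(\<Sum>\<sigma> | \<sigma> permutes N. of_int (sign \<sigma>) * (a (\<sigma> i) * (\<Prod>j\<in>N-{i}. M j (\<sigma> j) z)))
      = a i * (\<Prod>j\<in>N-{i}. d j)" if "i \<in> N" for i and a :: "'i \<Rightarrow> complex"
  proof -
    have "N - (N - {i}) = {i}" using that by auto
    moreover have "(\<Sum>\<sigma> | \<sigma> permutes N. of_int (sign \<sigma>) * (a (\<sigma> i) * (\<Prod>j\<in>N-{i}. M j (\<sigma> j) z)))
      = (\<Sum>\<sigma> | \<sigma> permutes N. of_int (sign \<sigma>) * (a (\<sigma> i) * (\<Prod>j\<in>N-{i}. if j = \<sigma> j then d j else 0)))"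
      by (intro sum.cong refl) (simp add: prod0)
    ultimately show ?thesis
      by (simp add: sum_permutations_fixed_points[OF N, where a = "\<lambda>\<sigma>. a (\<sigma> i)"])
  qed
  \<comment> \<open>With rows \<open>i\<close> and \<open>j\<close> free, the identity and the
    transposition remain, the latter with sign -1, so a two-by-two determinant appears.\<close>
  have two: "(\<Sum>\<sigma> | \<sigma> permutes N. of_int (sign \<sigma>) * (a (\<sigma> i) * b (\<sigma> j) * (\<Prod>s\<in>N-{i}-{j}. M s (\<sigma> s) z)))
      = (a i * b j - a j * b i) * (\<Prod>s\<in>N-{i}-{j}. d s)"
    if "i \<in> N" "j \<in> N" "i \<noteq> j" for i j and a b :: "'i \<Rightarrow> complex"
  proof -
    have "N - (N - {i} - {j}) = {i, j}" using that by auto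
    moreover have "{\<sigma>. \<sigma> permutes {i, j}} = {id, Transposition.transpose i j}"
      by (auto simp: permutes_doubleton_iff)
    moreover have "Transposition.transpose i j \<noteq> id"
      using that(3) by (metis id_apply transpose_apply_first)
    moreover have "(\<Sum>\<sigma> | \<sigma> permutes N. of_int (sign \<sigma>) * (a (\<sigma> i) * b (\<sigma> j) * (\<Prod>s\<in>N-{i}-{j}. M s (\<sigma> s) z)))
      = (\<Sum>\<sigma> | \<sigma> permutes N. of_int (sign \<sigma>) *
          (a (\<sigma> i) * b (\<sigma> j) * (\<Prod>s\<in>N-{i}-{j}. if s = \<sigma> s then d s else 0)))"
      by (intro sum.cong refl arg_cong2[of _ _ _ _ "(*)"] prod0) auto
    moreover have "N - {i} - {j} \<subseteq> N" by blast
    ultimately show ?thesis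
      using that(3)
      by (simp add: sum_permutations_fixed_points[OF N, where a = "\<lambda>\<sigma>. a (\<sigma> i) * b (\<sigma> j)"] sign_swap_id)
  qed
  have W1: "wirt e k \<Delta> z = (\<Sum>i\<in>N. wirt e k (M i i) z * (\<Prod>j\<in>N-{i}. d j))" for e k
    unfolding W[OF S(2)] sum_distrib_left
    by (subst sum.swap) (intro sum.cong refl one[where a = "\<lambda>s. wirt e k (M _ s) z"])
  have "wirt e' k' (wirt e k \<Delta>) z = wirt e' k' W' z"
    by (rule wirt_cong[OF S WW'])
  also have "\<dots> = (\<Sum>\<sigma> | \<sigma> permutes N. of_int (sign \<sigma>) * (\<Sum>i\<in>N.
      wirt e' k' (wirt e k (M i (\<sigma> i))) z * (\<Prod>j\<in>N-{i}. M j (\<sigma> j) z) +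
      wirt e k (M i (\<sigma> i)) z * (\<Sum>j\<in>N-{i}. wirt e' k' (M j (\<sigma> j)) z * (\<Prod>s\<in>N-{i}-{j}. M s (\<sigma> s) z))))"
    unfolding W'_def
  proof (subst wirt_sum[OF fin], goal_cases)
    case 1 then show ?case using N S
      by (auto intro!: differentiable_sum differentiable_mult differentiable_prod M' M2')
  next
    case 2 show ?case
    proof (rule sum.cong[OF refl], subst wirt_cmult, goal_cases)
      case 1 then show ?case using N S
        by (auto intro!: differentiable_sum differentiable_mult differentiable_prod M' M2')
    next
      case (2 \<sigma>)
      then have \<sigma>: "\<sigma> permutes N" by simp
      show ?case
      proof (subst wirt_sum[OF N], goal_cases)
        case 1 then show ?case using N S \<sigma>
          by (auto intro!: differentiable_sum differentiable_mult differentiable_prod M' M2')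
      next
        case 2 show ?case
          using \<sigma> S N
          by (intro arg_cong2[of _ _ _ _ "(*)"] sum.cong refl, subst wirt_mult)
            (auto intro!: differentiable_prod M' M2' wirt_prod)
      qed
    qed
  qed
  \<comment> \<open>Terms in which one row carries both derivatives are evaluated by
    \<open>one\<close>, those in which two distinct rows carry one derivative each by
    \<open>two\<close>.\<close>
  also have "\<dots> = (\<Sum>i\<in>N. wirt e' k' (wirt e k (M i i)) z * (\<Prod>j\<in>N-{i}. d j)) +
     (\<Sum>i\<in>N. \<Sum>j\<in>N-{i}. (wirt e k (M i i) z * wirt e' k' (M j j) z - wirt e k (M i j) z * wirt e' k' (M j i) z)
        * (\<Prod>s\<in>N-{i}-{j}. d s))"
  proof -
    have "(\<Sum>\<sigma> | \<sigma> permutes N. of_int (sign \<sigma>) * (\<Sum>i\<in>N.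
      wirt e' k' (wirt e k (M i (\<sigma> i))) z * (\<Prod>j\<in>N-{i}. M j (\<sigma> j) z) +
      wirt e k (M i (\<sigma> i)) z * (\<Sum>j\<in>N-{i}. wirt e' k' (M j (\<sigma> j)) z * (\<Prod>s\<in>N-{i}-{j}. M s (\<sigma> s) z))))
     = (\<Sum>\<sigma> | \<sigma> permutes N. \<Sum>i\<in>N. of_int (sign \<sigma>) *
          (wirt e' k' (wirt e k (M i (\<sigma> i))) z * (\<Prod>j\<in>N-{i}. M j (\<sigma> j) z))) +
       (\<Sum>\<sigma> | \<sigma> permutes N. \<Sum>i\<in>N. \<Sum>j\<in>N-{i}. of_int (sign \<sigma>) *
          (wirt e k (M i (\<sigma> i)) z * wirt e' k' (M j (\<sigma> j)) z * (\<Prod>s\<in>N-{i}-{j}. M s (\<sigma> s) z)))"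
      by (simp add: sum.distrib sum_distrib_left distrib_left mult.assoc)
    also have "(\<Sum>\<sigma> | \<sigma> permutes N. \<Sum>i\<in>N. of_int (sign \<sigma>) *
          (wirt e' k' (wirt e k (M i (\<sigma> i))) z * (\<Prod>j\<in>N-{i}. M j (\<sigma> j) z))) =
        (\<Sum>i\<in>N. wirt e' k' (wirt e k (M i i)) z * (\<Prod>j\<in>N-{i}. d j))"
      by (subst sum.swap) (intro sum.cong refl one[where a = "\<lambda>s. wirt e' k' (wirt e k (M _ s)) z"])
    also have "(\<Sum>\<sigma> | \<sigma> permutes N. \<Sum>i\<in>N. \<Sum>j\<in>N-{i}. of_int (sign \<sigma>) *
          (wirt e k (M i (\<sigma> i)) z * wirt e' k' (M j (\<sigma> j)) z * (\<Prod>s\<in>N-{i}-{j}. M s (\<sigma> s) z))) =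
        (\<Sum>i\<in>N. \<Sum>j\<in>N-{i}. \<Sum>\<sigma> | \<sigma> permutes N. of_int (sign \<sigma>) *
          (wirt e k (M i (\<sigma> i)) z * wirt e' k' (M j (\<sigma> j)) z * (\<Prod>s\<in>N-{i}-{j}. M s (\<sigma> s) z)))"
      by (subst sum.swap, rule sum.cong[OF refl], rule sum.swap)
    also have "\<dots> = (\<Sum>i\<in>N. \<Sum>j\<in>N-{i}.
        (wirt e k (M i i) z * wirt e' k' (M j j) z - wirt e k (M i j) z * wirt e' k' (M j i) z)
        * (\<Prod>s\<in>N-{i}-{j}. d s))"
      by (intro sum.cong refl two[where a = "\<lambda>s. wirt e k (M _ s) z" and b = "\<lambda>s. wirt e' k' (M _ s) z"]) auto
    finally show ?thesis .
  qed
  finally have W2: "wirt e' k' (wirt e k \<Delta>) z = (\<Sum>i\<in>N. wirt e' k' (wirt e k (M i i)) z * (\<Prod>j\<in>N-{i}. d j)) +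
     (\<Sum>i\<in>N. \<Sum>j\<in>N-{i}. (wirt e k (M i i) z * wirt e' k' (M j j) z - wirt e k (M i j) z * wirt e' k' (M j i) z)
        * (\<Prod>s\<in>N-{i}-{j}. d s))" .
  assume nz: "\<And>i. i \<in> N \<Longrightarrow> d i \<noteq> 0"
  define D where "D = (\<Prod>i\<in>N. d i)"
  have D: "D \<noteq> 0" using nz N by (simp add: D_def)
  have D1: "(\<Prod>j\<in>N-{i}. d j) = D / d i" if "i \<in> N" for i
    using prod.remove[OF N that, of d] nz[OF that] by (simp add: D_def)
  have D2: "(\<Prod>s\<in>N-{i}-{j}. d s) = D / (d i * d j)" if "i \<in> N" "j \<in> N - {i}" for i j
    using prod.remove[OF _ that(2), of d] nz[of i] nz[of j] that N by (simp add: D1 field_simps)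
  let ?m = "\<lambda>i j. wirt e k (M i j) z" and ?n = "\<lambda>i j. wirt e' k' (M i j) z"
  have "wirt e' k' (wirt e k \<Delta>) z / D = (\<Sum>i\<in>N. wirt e' k' (wirt e k (M i i)) z / d i) +
     (\<Sum>i\<in>N. \<Sum>j\<in>N-{i}. (?m i i * ?n j j - ?m i j * ?n j i) / (d i * d j))"
    using D by (simp add: W2 D1 D2 add_divide_distrib sum_divide_distrib)
  \<comment> \<open>For \<open>j = i\<close> the numerator vanishes, so the inner sum may run over
    all of \<open>N\<close>. Its first part then factors into a product of two traces, which is the
    term subtracted by the second derivative of the logarithm.\<close>
  also have "(\<Sum>i\<in>N. \<Sum>j\<in>N-{i}. (?m i i * ?n j j - ?m i j * ?n j i) / (d i * d j)) =
     (\<Sum>i\<in>N. \<Sum>j\<in>N. (?m i i * ?n j j - ?m i j * ?n j i) / (d i * d j))"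
    using N by (intro sum.cong refl sum.mono_neutral_left) auto
  also have "\<dots> = (\<Sum>i\<in>N. \<Sum>j\<in>N. (?m i i / d i) * (?n j j / d j)) - (\<Sum>i\<in>N. \<Sum>j\<in>N. ?m i j * ?n j i / (d i * d j))"
    by (simp add: diff_divide_distrib sum_subtractf)
  also have "(\<Sum>i\<in>N. \<Sum>j\<in>N. (?m i i / d i) * (?n j j / d j)) = (\<Sum>i\<in>N. ?m i i / d i) * (\<Sum>j\<in>N. ?n j j / d j)"
    by (simp add: sum_product)
  also have "\<dots> = wirt e k \<Delta> z * wirt e' k' \<Delta> z / D\<^sup>2"
  proof -
    have "wirt e k \<Delta> z = D * (\<Sum>i\<in>N. wirt e k (M i i) z / d i)" for e k
      unfolding W1 sum_distrib_left by (intro sum.cong refl) (simp add: D1)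
    then show ?thesis using D by (simp add: power2_eq_square)
  qed
  finally show "wirt e' k' (wirt e k \<Delta>) z / \<Delta> z - wirt e k \<Delta> z * wirt e' k' \<Delta> z / (\<Delta> z)\<^sup>2 =
      (\<Sum>i\<in>N. wirt e' k' (wirt e k (M i i)) z / d i) -
      (\<Sum>i\<in>N. \<Sum>j\<in>N. ?m i j * ?n j i / (d i * d j))"
    unfolding \<Delta>z D_def[symmetric] by simp
qed

section \<open>Smooth coefficients, leading minors, and curvature in a unitary frame\<close>

lemma differentiable_cong_open:
  assumes "open S" "z \<in> S" "\<And>x. x \<in> S \<Longrightarrow> F x = G x" "G differentiable at z"
  shows "F differentiable at z"
proof -
  obtain L where "(G has_derivative L) (at z)" using assms(4) unfolding differentiable_def by blast
  then have "(F has_derivative L) (at z)"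
    by (rule has_derivative_transform_within_open[OF _ assms(1,2)]) (simp add: assms(3))
  then show ?thesis unfolding differentiable_def by blast
qed

lemma smooth_on_differentiable:
  assumes "smooth_on S F" "z \<in> S"
  shows "F differentiable at z"
  using assms unfolding smooth_on_def by (metis Ck_on.simps(2))

text \<open>A Wirtinger derivative is a fixed linear combination of Frechet derivatives in two
  directions, and level 2 of \<open>Ck_on\<close> makes these differentiable.\<close>

lemma smooth_on_wirt_differentiable:
  assumes S: "open S" and F: "smooth_on S F" and z: "z \<in> S"
  shows "wirt e k F differentiable at z"
proof (rule differentiable_cong_open[OF S z])
  fix x assume "x \<in> S"
  then have "(F has_derivative frechet_derivative F (at x)) (at x)"
    using smooth_on_differentiable[OF F] frechet_derivative_works by blast
  then show "wirt e k F x =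
      (frechet_derivative F (at x) (axis k 1) + e * frechet_derivative F (at x) (axis k \<i>)) * (1 / 2)"
    by (simp add: wirt_has_derivative)
next
  have "Ck_on (Suc (Suc 0)) S F" using F unfolding smooth_on_def by blast
  then have "(\<lambda>x. frechet_derivative F (at x) v) differentiable at z" for v
    using z by simp
  then show "(\<lambda>x. (frechet_derivative F (at x) (axis k 1) + e * frechet_derivative F (at x) (axis k \<i>)) * (1 / 2))
      differentiable at z"
    by (intro differentiable_mult differentiable_add differentiable_const)
qed

text \<open>Connects the matrix determinant, with rows and columns numbered from 0, to the
  permutation sums above; \<open>Suc\<close> restores the numbering of coordinates from 1.\<close>

lemma leading_minor_leibniz:
  "leading_minor a l F = (\<lambda>x. \<Sum>\<sigma> | \<sigma> permutes {0..<l}.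
     of_int (sign \<sigma>) * (\<Prod>i\<in>{0..<l}. F (a (Suc i)) (a (Suc (\<sigma> i))) x))"
proof
  fix x
  let ?A = "Matrix.mat l l (\<lambda>(r, s). F (a (Suc r)) (a (Suc s)) x)"
  have "leading_minor a l F x = (\<Sum>\<sigma> | \<sigma> permutes {0..<l}. signof \<sigma> * (\<Prod>i = 0..<l. ?A $$ (i, \<sigma> i)))"
    unfolding leading_minor_def by (rule det_def') simp
  also have "\<dots> = (\<Sum>\<sigma> | \<sigma> permutes {0..<l}.
     of_int (sign \<sigma>) * (\<Prod>i\<in>{0..<l}. F (a (Suc i)) (a (Suc (\<sigma> i))) x))"
  proof (rule sum.cong[OF refl])
    fix \<sigma> assume "\<sigma> \<in> {\<sigma>. \<sigma> permutes {0..<l}}"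
    then have "(\<Prod>i = 0..<l. ?A $$ (i, \<sigma> i)) = (\<Prod>i\<in>{0..<l}. F (a (Suc i)) (a (Suc (\<sigma> i))) x)"
      by (intro prod.cong refl) (auto simp: permutes_in_image dest: permutes_in_image)
    then show "signof \<sigma> * (\<Prod>i = 0..<l. ?A $$ (i, \<sigma> i)) =
       of_int (sign \<sigma>) * (\<Prod>i\<in>{0..<l}. F (a (Suc i)) (a (Suc (\<sigma> i))) x)"
      by simp
  qed
  finally show "leading_minor a l F x = \<dots>" .
qed

text \<open>The determinant formulas are transported to the labels \<open>{1..l}\<close>.
  Injectivity of \<open>a\<close> makes different positions of the block different coordinates, so
  the block is diagonal as well.\<close>

lemma
  assumes S: "open S" "z \<in> S"
    and F: "\<And>\<alpha> \<beta> x. x \<in> S \<Longrightarrow> F \<alpha> \<beta> differentiable at x"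
    and F2: "\<And>\<alpha> \<beta>. wirt e k (F \<alpha> \<beta>) differentiable at z"
    and diag: "\<And>\<alpha> \<beta>. F \<alpha> \<beta> z = (if \<alpha> = \<beta> then d \<alpha> else 0)"
    and a: "inj_on a {1..l}"
  shows leading_minor_differentiable: "x \<in> S \<Longrightarrow> leading_minor a l F differentiable at x"
    and wirt_leading_minor_differentiable: "wirt e k (leading_minor a l F) differentiable at z"
    and leading_minor_diagonal: "leading_minor a l F z = (\<Prod>\<alpha>=1..l. d (a \<alpha>))"
    and wirt_wirt_ln_leading_minor: "(\<And>\<alpha>. \<alpha> \<in> {1..l} \<Longrightarrow> d (a \<alpha>) \<noteq> 0) \<Longrightarrow>
      wirt e' k' (wirt e k (leading_minor a l F)) z / leading_minor a l F z -
        wirt e k (leading_minor a l F) z * wirt e' k' (leading_minor a l F) z / (leading_minor a l F z)\<^sup>2 =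
      (\<Sum>\<alpha>=1..l. wirt e' k' (wirt e k (F (a \<alpha>) (a \<alpha>))) z / d (a \<alpha>)) -
      (\<Sum>\<alpha>=1..l. \<Sum>\<beta>=1..l. wirt e k (F (a \<alpha>) (a \<beta>)) z * wirt e' k' (F (a \<beta>) (a \<alpha>)) z / (d (a \<alpha>) * d (a \<beta>)))"
proof -
  define M where "M = (\<lambda>i j. F (a (Suc i)) (a (Suc j)))"
  define c where "c = (\<lambda>i. d (a (Suc i)))"
  have lm: "leading_minor a l F =
      (\<lambda>x. \<Sum>\<sigma> | \<sigma> permutes {0..<l}. of_int (sign \<sigma>) * (\<Prod>i\<in>{0..<l}. M i (\<sigma> i) x))"
    by (simp add: leading_minor_leibniz M_def)
  have M: "M i j differentiable at x" if "x \<in> S" for i j x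
    using F[OF that] by (simp add: M_def)
  have M2: "wirt e k (M i j) differentiable at z" for i j
    using F2 by (simp add: M_def)
  have Md: "M i j z = (if i = j then c i else 0)" if "i \<in> {0..<l}" "j \<in> {0..<l}" for i j
    using that inj_onD[OF a, of "Suc i" "Suc j"] by (auto simp: M_def c_def diag)
  have set: "{1..l} = Suc ` {0..<l}" by (simp add: image_Suc_atLeastLessThan atLeastLessThanSuc_atLeastAtMost)
  have sum_shift: "(\<Sum>\<alpha>=1..l. g \<alpha>) = (\<Sum>i\<in>{0..<l}. g (Suc i))"
    and prod_shift: "(\<Prod>\<alpha>=1..l. g \<alpha>) = (\<Prod>i\<in>{0..<l}. g (Suc i))" for g :: "nat \<Rightarrow> complex"
    unfolding set by (simp_all only: sum.reindex[OF inj_Suc[THEN inj_on_subset, OF subset_UNIV]] prod.reindex[OF inj_Suc[THEN inj_on_subset, OF subset_UNIV]] o_def)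
  show "x \<in> S \<Longrightarrow> leading_minor a l F differentiable at x"
    unfolding lm by (rule leibniz_det_differentiable[OF S finite_atLeastLessThan M M2 Md])
  show "wirt e k (leading_minor a l F) differentiable at z"
    unfolding lm by (rule wirt_leibniz_det_differentiable[OF S finite_atLeastLessThan M M2 Md])
  have "leading_minor a l F z = (\<Prod>i\<in>{0..<l}. c i)"
    unfolding lm by (rule leibniz_det_diagonal[OF S finite_atLeastLessThan M M2 Md])
  then show "leading_minor a l F z = (\<Prod>\<alpha>=1..l. d (a \<alpha>))"
    by (simp only: prod_shift c_def)
  assume nz: "\<And>\<alpha>. \<alpha> \<in> {1..l} \<Longrightarrow> d (a \<alpha>) \<noteq> 0"
  have nzc: "c i \<noteq> 0" if "i \<in> {0..<l}" for i
    using nz[of "Suc i"] that by (simp add: c_def)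
  have "wirt e' k' (wirt e k (leading_minor a l F)) z / leading_minor a l F z -
        wirt e k (leading_minor a l F) z * wirt e' k' (leading_minor a l F) z / (leading_minor a l F z)\<^sup>2 =
      (\<Sum>i\<in>{0..<l}. wirt e' k' (wirt e k (M i i)) z / c i) -
      (\<Sum>i\<in>{0..<l}. \<Sum>j\<in>{0..<l}. wirt e k (M i j) z * wirt e' k' (M j i) z / (c i * c j))"
    unfolding lm by (rule wirt_wirt_ln_leibniz_det[OF S finite_atLeastLessThan M M2 Md nzc])
  then show "wirt e' k' (wirt e k (leading_minor a l F)) z / leading_minor a l F z -
        wirt e k (leading_minor a l F) z * wirt e' k' (leading_minor a l F) z / (leading_minor a l F z)\<^sup>2 =
      (\<Sum>\<alpha>=1..l. wirt e' k' (wirt e k (F (a \<alpha>) (a \<alpha>))) z / d (a \<alpha>)) -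
      (\<Sum>\<alpha>=1..l. \<Sum>\<beta>=1..l. wirt e k (F (a \<alpha>) (a \<beta>)) z * wirt e' k' (F (a \<beta>) (a \<alpha>)) z / (d (a \<alpha>) * d (a \<beta>)))"
    by (simp only: sum_shift c_def M_def)
qed

text \<open>At a point where the metric matrix is the identity so is its inverse, and the double sum
  in the curvature collapses to its diagonal.\<close>

lemma chern_curv_unitary_frame:
  assumes "\<And>r s. H r s w = (if r = s then 1 else 0)"
  shows "chern_curv H i j k l w =
    - pd i (pdbar j (H k l)) w + (\<Sum>q\<in>UNIV. pd i (H k q) w * pdbar j (H q l) w)"
proof -
  have id: "(\<chi> r s. H r s w) = Finite_Cartesian_Product.mat 1"
    by (simp add: assms Finite_Cartesian_Product.mat_def)
  \<comment> \<open>\<open>matrix_inv\<close> is defined by choice; for the identity matrix the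
    defining equations leave only one candidate.\<close>
  have "matrix_inv (Finite_Cartesian_Product.mat 1 :: complex^'a^'a) = Finite_Cartesian_Product.mat 1"
    unfolding matrix_inv_def by (rule some_equality) simp_all
  then have inv: "metric_inv H p q w = (if p = q then 1 else 0)" for p q
    by (auto simp: metric_inv_def id Finite_Cartesian_Product.mat_def)
  have "(\<Sum>q\<in>UNIV. metric_inv H p q w * pd i (H k q) w * pdbar j (H p l) w) =
      pd i (H k p) w * pdbar j (H p l) w" for p
  proof -
    have "(\<Sum>q\<in>UNIV. metric_inv H p q w * pd i (H k q) w * pdbar j (H p l) w) =
      (\<Sum>q\<in>UNIV. if q = p then pd i (H k p) w * pdbar j (H p l) w else 0)"
      by (intro sum.cong refl) (auto simp: inv)
    then show ?thesis by simp
  qed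
  then show ?thesis by (simp add: chern_curv_def)
qed

lemma differentiable_cnj: "F differentiable at z \<Longrightarrow> (\<lambda>x. cnj (F x)) differentiable at z"
  unfolding differentiable_def using has_derivative_cnj by blast

lemmas pd_add = wirt_add[where e = "- \<i>", folded pd_wirt]
  and pd_mult = wirt_mult[where e = "- \<i>", folded pd_wirt]
  and pd_sum = wirt_sum[where e = "- \<i>", folded pd_wirt]
  and pd_cong = wirt_cong[where e = "- \<i>", folded pd_wirt]
  and pdbar_mult = wirt_mult[where e = "\<i>", folded pdbar_wirt]
  and pdbar_sum = wirt_sum[where e = "\<i>", folded pdbar_wirt]

lemma pd_cnj: "F differentiable at z \<Longrightarrow> pd k (\<lambda>x. cnj (F x)) z = cnj (pdbar k F z)"
  and pdbar_cnj: "F differentiable at z \<Longrightarrow> pdbar k (\<lambda>x. cnj (F x)) z = cnj (pd k F z)"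
  by (simp_all add: pd_wirt pdbar_wirt wirt_cnj)

lemma differentiable_compose_at:
  assumes "F differentiable at z" "H differentiable at (F z)"
  shows "(\<lambda>x. H (F x)) differentiable at z"
  using assms has_derivative_compose unfolding differentiable_def by blast

lemma mholomorphic_on_differentiable: "mholomorphic_on F S \<Longrightarrow> z \<in> S \<Longrightarrow> F differentiable at z"
  unfolding mholomorphic_on_def differentiable_def by blast

lemma
  assumes "mholomorphic_on F S" "z \<in> S" "H differentiable at (F z)"
  shows pd_mholomorphic_chain:
      "pd k (\<lambda>x. H (F x)) z = (\<Sum>i\<in>UNIV. pd i H (F z) * pd k (\<lambda>x. F x $ i) z)"
    and pdbar_mholomorphic_chain:
      "pdbar k (\<lambda>x. H (F x)) z = (\<Sum>i\<in>UNIV. pdbar i H (F z) * cnj (pd k (\<lambda>x. F x $ i) z))"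
  using assms pd_chain pdbar_chain unfolding mholomorphic_on_def by blast+

section \<open>Derivatives of the pull-back metric, first on an open set and then at the base
  point\<close>

section \<open>The pull-back metric in coordinates\<close>

text \<open>Chart-free counterpart of \<open>pullback_coeff\<close>: \<open>F\<close> is the local
  representative of the map and \<open>H\<close> the family of metric coefficients.\<close>

definition pullback ::
    "(complex^'m::finite \<Rightarrow> complex^'n::finite) \<Rightarrow> ('n \<Rightarrow> 'n \<Rightarrow> complex^'n \<Rightarrow> complex) \<Rightarrow>
     'm \<Rightarrow> 'm \<Rightarrow> complex^'m \<Rightarrow> complex" where
  "pullback F H \<alpha> \<beta> x = (\<Sum>i\<in>UNIV. \<Sum>j\<in>UNIV.
     pd \<alpha> (\<lambda>w. F w $ i) x * cnj (pd \<beta> (\<lambda>w. F w $ j) x) * H i j (F x))"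

text \<open>Each summand is a holomorphic factor, an antiholomorphic factor and a coefficient of
  \<open>H\<close> along \<open>F\<close>. \<open>pd\<close> annihilates the second factor and
  \<open>pdbar\<close> the first, so the mixed derivative has four groups, according to whether each
  operator acts on \<open>H\<close> or on a derivative of \<open>F\<close>.\<close>

lemma
  fixes F :: "complex^'m::finite \<Rightarrow> complex^'n::finite"
  assumes U: "open U" and F: "mholomorphic_on F U"
    and V: "open V" "F ` U \<subseteq> V" and H: "\<And>i j. smooth_on V (H i j)"
    and x: "x \<in> U"
  shows pullback_differentiable: "pullback F H \<alpha> \<beta> differentiable at x"
    and pd_pullback: "pd \<gamma> (pullback F H \<alpha> \<beta>) x =
      (\<Sum>i\<in>UNIV. \<Sum>j\<in>UNIV. cnj (pd \<beta> (\<lambda>w. F w $ j) x) *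
        (pd \<gamma> (pd \<alpha> (\<lambda>w. F w $ i)) x * H i j (F x) +
         pd \<alpha> (\<lambda>w. F w $ i) x * (\<Sum>k\<in>UNIV. pd k (H i j) (F x) * pd \<gamma> (\<lambda>w. F w $ k) x)))"
    and pdbar_pullback: "pdbar \<delta> (pullback F H \<alpha> \<beta>) x =
      (\<Sum>i\<in>UNIV. \<Sum>j\<in>UNIV. pd \<alpha> (\<lambda>w. F w $ i) x *
        (cnj (pd \<delta> (pd \<beta> (\<lambda>w. F w $ j)) x) * H i j (F x) +
         cnj (pd \<beta> (\<lambda>w. F w $ j) x) * (\<Sum>k\<in>UNIV. pdbar k (H i j) (F x) * cnj (pd \<delta> (\<lambda>w. F w $ k) x))))"
    and pdbar_pullback_differentiable: "pdbar \<delta> (pullback F H \<alpha> \<beta>) differentiable at x"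
    and pd_pdbar_pullback: "pd \<gamma> (pdbar \<delta> (pullback F H \<alpha> \<beta>)) x =
      (\<Sum>i\<in>UNIV. \<Sum>j\<in>UNIV.
        pd \<gamma> (pd \<alpha> (\<lambda>w. F w $ i)) x * cnj (pd \<delta> (pd \<beta> (\<lambda>w. F w $ j)) x) * H i j (F x)) +
      (\<Sum>i\<in>UNIV. \<Sum>j\<in>UNIV. pd \<gamma> (pd \<alpha> (\<lambda>w. F w $ i)) x * cnj (pd \<beta> (\<lambda>w. F w $ j) x) *
        (\<Sum>k\<in>UNIV. pdbar k (H i j) (F x) * cnj (pd \<delta> (\<lambda>w. F w $ k) x))) +
      (\<Sum>i\<in>UNIV. \<Sum>j\<in>UNIV. pd \<alpha> (\<lambda>w. F w $ i) x * cnj (pd \<delta> (pd \<beta> (\<lambda>w. F w $ j)) x) *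
        (\<Sum>k\<in>UNIV. pd k (H i j) (F x) * pd \<gamma> (\<lambda>w. F w $ k) x)) +
      (\<Sum>i\<in>UNIV. \<Sum>j\<in>UNIV. pd \<alpha> (\<lambda>w. F w $ i) x * cnj (pd \<beta> (\<lambda>w. F w $ j) x) *
        (\<Sum>k\<in>UNIV. (\<Sum>k'\<in>UNIV. pd k' (pdbar k (H i j)) (F x) * pd \<gamma> (\<lambda>w. F w $ k') x) *
          cnj (pd \<delta> (\<lambda>w. F w $ k) x)))"
proof -
  let ?u = "\<lambda>\<alpha> i. pd \<alpha> (\<lambda>w. F w $ i)"
  have hol: "cholomorphic_on (?u \<alpha> i) U" for \<alpha> i
    by (rule cholomorphic_on_pd[OF U cholomorphic_on_component[OF F]])
  have hol2: "cholomorphic_on (pd \<gamma> (?u \<alpha> i)) U" for \<gamma> \<alpha> i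
    by (rule cholomorphic_on_pd[OF U hol])
  have u: "?u \<alpha> i differentiable at y" "pdbar \<delta> (?u \<alpha> i) y = 0"
    "pd \<gamma> (?u \<alpha> i) differentiable at y" "pdbar \<delta> (pd \<gamma> (?u \<alpha> i)) y = 0" if "y \<in> U" for \<alpha> \<gamma> \<delta> i y
    using that hol hol2 cholomorphic_on_differentiable cholomorphic_on_pdbar by blast+
  have cu: "(\<lambda>x. cnj (?u \<alpha> i x)) differentiable at y" "pd \<delta> (\<lambda>x. cnj (?u \<alpha> i x)) y = 0"
    "pdbar \<delta> (\<lambda>x. cnj (?u \<alpha> i x)) y = cnj (pd \<delta> (?u \<alpha> i) y)"
    "(\<lambda>x. cnj (pd \<gamma> (?u \<alpha> i) x)) differentiable at y"
    "pd \<delta> (\<lambda>x. cnj (pd \<gamma> (?u \<alpha> i) x)) y = 0" if "y \<in> U" for \<alpha> \<gamma> \<delta> i y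
    using u[OF that] by (simp_all add: differentiable_cnj pd_cnj pdbar_cnj)
  have FV: "F y \<in> V" if "y \<in> U" for y using V(2) that by blast
  have dF: "F differentiable at y" if "y \<in> U" for y
    by (rule mholomorphic_on_differentiable[OF F that])
  have h0: "H i j differentiable at (F y)" "pdbar k (H i j) differentiable at (F y)" if "y \<in> U" for i j k y
    using smooth_on_differentiable[OF H FV[OF that]]
      smooth_on_wirt_differentiable[OF V(1) H FV[OF that], where e = "\<i>", folded pdbar_wirt] by blast+
  have h: "(\<lambda>x. H i j (F x)) differentiable at y" "(\<lambda>x. pdbar k (H i j) (F x)) differentiable at y"
    if "y \<in> U" for i j k y
    using h0[OF that] dF[OF that] by (blast intro: differentiable_compose_at)+
  have eq: "pullback F H \<alpha> \<beta> = (\<lambda>x. \<Sum>i\<in>UNIV. \<Sum>j\<in>UNIV. ?u \<alpha> i x * cnj (?u \<beta> j x) * H i j (F x))"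
    by (simp add: pullback_def fun_eq_iff)
  note chain = pd_mholomorphic_chain[OF F] pdbar_mholomorphic_chain[OF F]
  note d = u cu h differentiable_mult differentiable_add differentiable_sum
  show "pullback F H \<alpha> \<beta> differentiable at x"
    unfolding eq by (simp add: d x)
  show "pd \<gamma> (pullback F H \<alpha> \<beta>) x =
      (\<Sum>i\<in>UNIV. \<Sum>j\<in>UNIV. cnj (?u \<beta> j x) * (pd \<gamma> (?u \<alpha> i) x * H i j (F x) +
         ?u \<alpha> i x * (\<Sum>k\<in>UNIV. pd k (H i j) (F x) * ?u \<gamma> k x)))"
    unfolding eq by (simp add: d x pd_sum pd_mult chain h0 algebra_simps)
  have pdbar_eq: "pdbar \<delta> (pullback F H \<alpha> \<beta>) y =
      (\<Sum>i\<in>UNIV. \<Sum>j\<in>UNIV. ?u \<alpha> i y * (cnj (pd \<delta> (?u \<beta> j) y) * H i j (F y) +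
         cnj (?u \<beta> j y) * (\<Sum>k\<in>UNIV. pdbar k (H i j) (F y) * cnj (?u \<delta> k y))))"
    if "y \<in> U" for y
    unfolding eq by (simp add: d that pdbar_sum pdbar_mult chain h0 algebra_simps)
  from pdbar_eq[OF x] show "pdbar \<delta> (pullback F H \<alpha> \<beta>) x =
      (\<Sum>i\<in>UNIV. \<Sum>j\<in>UNIV. ?u \<alpha> i x * (cnj (pd \<delta> (?u \<beta> j) x) * H i j (F x) +
         cnj (?u \<beta> j x) * (\<Sum>k\<in>UNIV. pdbar k (H i j) (F x) * cnj (?u \<delta> k x))))" .
  \<comment> \<open>The first derivative has this closed form on all of \<open>U\<close>, so
    \<open>E\<close> may replace it under a further \<open>pd\<close>.\<close>
  define E where "E = (\<lambda>x. \<Sum>i\<in>UNIV. \<Sum>j\<in>UNIV. ?u \<alpha> i x * (cnj (pd \<delta> (?u \<beta> j) x) * H i j (F x) +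
         cnj (?u \<beta> j x) * (\<Sum>k\<in>UNIV. pdbar k (H i j) (F x) * cnj (?u \<delta> k x))))"
  show "pdbar \<delta> (pullback F H \<alpha> \<beta>) differentiable at x"
    by (rule differentiable_cong_open[OF U x pdbar_eq]) (simp_all add: d x)
  have "pd \<gamma> (pdbar \<delta> (pullback F H \<alpha> \<beta>)) x = pd \<gamma> E x"
    unfolding E_def by (rule pd_cong[OF U x pdbar_eq])
  also have "\<dots> = (\<Sum>i\<in>UNIV. \<Sum>j\<in>UNIV.
        pd \<gamma> (?u \<alpha> i) x * (cnj (pd \<delta> (?u \<beta> j) x) * H i j (F x) +
           cnj (?u \<beta> j x) * (\<Sum>k\<in>UNIV. pdbar k (H i j) (F x) * cnj (?u \<delta> k x))) +
        ?u \<alpha> i x * (cnj (pd \<delta> (?u \<beta> j) x) * (\<Sum>k\<in>UNIV. pd k (H i j) (F x) * ?u \<gamma> k x) +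
           cnj (?u \<beta> j x) * (\<Sum>k\<in>UNIV. (\<Sum>k'\<in>UNIV. pd k' (pdbar k (H i j)) (F x) * ?u \<gamma> k' x) *
             cnj (?u \<delta> k x))))"
    unfolding E_def by (simp add: d x pd_sum pd_mult pd_add chain h0)
  finally show "pd \<gamma> (pdbar \<delta> (pullback F H \<alpha> \<beta>)) x =
      (\<Sum>i\<in>UNIV. \<Sum>j\<in>UNIV. pd \<gamma> (?u \<alpha> i) x * cnj (pd \<delta> (?u \<beta> j) x) * H i j (F x)) +
      (\<Sum>i\<in>UNIV. \<Sum>j\<in>UNIV. pd \<gamma> (?u \<alpha> i) x * cnj (?u \<beta> j x) *
        (\<Sum>k\<in>UNIV. pdbar k (H i j) (F x) * cnj (?u \<delta> k x))) +
      (\<Sum>i\<in>UNIV. \<Sum>j\<in>UNIV. ?u \<alpha> i x * cnj (pd \<delta> (?u \<beta> j) x) *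
        (\<Sum>k\<in>UNIV. pd k (H i j) (F x) * ?u \<gamma> k x)) +
      (\<Sum>i\<in>UNIV. \<Sum>j\<in>UNIV. ?u \<alpha> i x * cnj (?u \<beta> j x) *
        (\<Sum>k\<in>UNIV. (\<Sum>k'\<in>UNIV. pd k' (pdbar k (H i j)) (F x) * ?u \<gamma> k' x) * cnj (?u \<delta> k x)))"
    by (simp only: distrib_left sum.distrib mult.assoc add.assoc)
qed

text \<open>The diagonal differential collapses the sums. Three of the four groups of the mixed
  derivative are three of the four products in \<open>\<Sum> P Q\<close>. The fourth product, of
  first derivatives of \<open>H\<close>, is the quadratic part of the Chern curvature, and the
  remaining group supplies its second-derivative part.\<close>

lemma
  fixes F :: "complex^'m::finite \<Rightarrow> complex^'n::finite" and \<iota> :: "'m \<Rightarrow> 'n" and \<Lambda> :: "'m \<Rightarrow> complex"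
  assumes U: "open U" "z \<in> U" and F: "mholomorphic_on F U"
    and V: "open V" "F ` U \<subseteq> V" and H: "\<And>i j. smooth_on V (H i j)"
    and H1: "\<And>i j. H i j (F z) = (if i = j then 1 else 0)"
    and dF: "\<And>\<alpha> i. pd \<alpha> (\<lambda>w. F w $ i) z = (if i = \<iota> \<alpha> then \<Lambda> \<alpha> else 0)"
    and \<iota>: "inj \<iota>"
  defines "P \<equiv> \<lambda>\<alpha> \<gamma> i. pd \<alpha> (pd \<gamma> (\<lambda>w. F w $ i)) z + pd (\<iota> \<gamma>) (H (\<iota> \<alpha>) i) (F z) * \<Lambda> \<alpha> * \<Lambda> \<gamma>"
    and "Q \<equiv> \<lambda>\<alpha> \<delta> i. cnj (pd \<alpha> (pd \<delta> (\<lambda>w. F w $ i)) z) +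
      pdbar (\<iota> \<delta>) (H i (\<iota> \<alpha>)) (F z) * cnj (\<Lambda> \<alpha>) * cnj (\<Lambda> \<delta>)"
  shows pullback_diagonal: "pullback F H \<alpha> \<beta> z = (if \<alpha> = \<beta> then \<Lambda> \<alpha> * cnj (\<Lambda> \<alpha>) else 0)"
    and pd_pullback_diagonal: "pd \<gamma> (pullback F H \<alpha> \<beta>) z = cnj (\<Lambda> \<beta>) * P \<alpha> \<gamma> (\<iota> \<beta>)"
    and pdbar_pullback_diagonal: "pdbar \<delta> (pullback F H \<alpha> \<beta>) z = \<Lambda> \<alpha> * Q \<beta> \<delta> (\<iota> \<alpha>)"
    and pd_pdbar_pullback_diagonal: "pd \<gamma> (pdbar \<delta> (pullback F H \<alpha> \<alpha>)) z =
      (\<Sum>i\<in>UNIV. P \<alpha> \<gamma> i * Q \<alpha> \<delta> i) -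
      \<Lambda> \<alpha> * cnj (\<Lambda> \<alpha>) * (chern_curv H (\<iota> \<gamma>) (\<iota> \<delta>) (\<iota> \<alpha>) (\<iota> \<alpha>) (F z) * \<Lambda> \<gamma> * cnj (\<Lambda> \<delta>))"
proof -
  \<comment> \<open>\<open>P\<close> and \<open>Q\<close> take the two derivatives of
    \<open>F\<close> in the opposite order to the general formulas.\<close>
  have swap: "pd \<alpha> (pd \<gamma> (\<lambda>w. F w $ i)) z = pd \<gamma> (pd \<alpha> (\<lambda>w. F w $ i)) z" for \<alpha> \<gamma> i
    by (rule pd_commute[OF U(1) cholomorphic_on_component[OF F] U(2)])
  have if0: "(if b then x else 0) * y = (if b then x * y else 0)"
    "y * (if b then x else 0) = (if b then y * x else 0)"
    "cnj (if b then x else 0) = (if b then cnj x else 0)" for b and x y :: complex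
    by auto
  have sum_if: "(\<Sum>j\<in>A. if b then f j else 0) = (if b then sum f A else 0)"
    for b and A :: "'n set" and f :: "'n \<Rightarrow> complex" by simp
  note collapse = dF H1 if0 sum_if
  show "pullback F H \<alpha> \<beta> z = (if \<alpha> = \<beta> then \<Lambda> \<alpha> * cnj (\<Lambda> \<alpha>) else 0)"
    using injD[OF \<iota>] by (auto simp: pullback_def collapse)
  show "pd \<gamma> (pullback F H \<alpha> \<beta>) z = cnj (\<Lambda> \<beta>) * P \<alpha> \<gamma> (\<iota> \<beta>)"
    unfolding pd_pullback[OF U(1) F V H U(2)] P_def
    by (simp add: collapse sum.distrib distrib_left swap[of \<alpha> \<gamma>] mult_ac)
  show "pdbar \<delta> (pullback F H \<alpha> \<beta>) z = \<Lambda> \<alpha> * Q \<beta> \<delta> (\<iota> \<alpha>)"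
    unfolding pdbar_pullback[OF U(1) F V H U(2)] Q_def
    by (simp add: collapse sum.distrib distrib_left swap[of \<beta> \<delta>] mult_ac)
  let ?f = "\<lambda>\<alpha> \<gamma> i. pd \<gamma> (pd \<alpha> (\<lambda>w. F w $ i)) z"
  let ?L = "\<Lambda> \<alpha> * cnj (\<Lambda> \<alpha>) * \<Lambda> \<gamma> * cnj (\<Lambda> \<delta>)"
  have "pd \<gamma> (pdbar \<delta> (pullback F H \<alpha> \<alpha>)) z =
      (\<Sum>i\<in>UNIV. ?f \<alpha> \<gamma> i * cnj (?f \<alpha> \<delta> i)) +
      (\<Sum>i\<in>UNIV. ?f \<alpha> \<gamma> i * (pdbar (\<iota> \<delta>) (H i (\<iota> \<alpha>)) (F z) * cnj (\<Lambda> \<alpha>) * cnj (\<Lambda> \<delta>))) +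
      (\<Sum>i\<in>UNIV. (pd (\<iota> \<gamma>) (H (\<iota> \<alpha>) i) (F z) * \<Lambda> \<alpha> * \<Lambda> \<gamma>) * cnj (?f \<alpha> \<delta> i)) +
      ?L * pd (\<iota> \<gamma>) (pdbar (\<iota> \<delta>) (H (\<iota> \<alpha>) (\<iota> \<alpha>))) (F z)"
    unfolding pd_pdbar_pullback[OF U(1) F V H U(2)]
    by (simp add: collapse mult_ac)
  also have "\<dots> = (\<Sum>i\<in>UNIV. P \<alpha> \<gamma> i * Q \<alpha> \<delta> i) -
      ?L * (\<Sum>i\<in>UNIV. pd (\<iota> \<gamma>) (H (\<iota> \<alpha>) i) (F z) * pdbar (\<iota> \<delta>) (H i (\<iota> \<alpha>)) (F z)) +
      ?L * pd (\<iota> \<gamma>) (pdbar (\<iota> \<delta>) (H (\<iota> \<alpha>) (\<iota> \<alpha>))) (F z)"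
  proof -
    have "(\<Sum>i\<in>UNIV. P \<alpha> \<gamma> i * Q \<alpha> \<delta> i) =
      (\<Sum>i\<in>UNIV. ?f \<alpha> \<gamma> i * cnj (?f \<alpha> \<delta> i)) +
      (\<Sum>i\<in>UNIV. ?f \<alpha> \<gamma> i * (pdbar (\<iota> \<delta>) (H i (\<iota> \<alpha>)) (F z) * cnj (\<Lambda> \<alpha>) * cnj (\<Lambda> \<delta>))) +
      (\<Sum>i\<in>UNIV. (pd (\<iota> \<gamma>) (H (\<iota> \<alpha>) i) (F z) * \<Lambda> \<alpha> * \<Lambda> \<gamma>) * cnj (?f \<alpha> \<delta> i)) +
      (\<Sum>i\<in>UNIV. ?L * (pd (\<iota> \<gamma>) (H (\<iota> \<alpha>) i) (F z) * pdbar (\<iota> \<delta>) (H i (\<iota> \<alpha>)) (F z)))"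
      unfolding P_def Q_def swap[of \<alpha> \<gamma>] swap[of \<alpha> \<delta>] sum.distrib[symmetric]
      by (intro sum.cong refl) (simp add: algebra_simps)
    then show ?thesis by (simp add: sum_distrib_left)
  qed
  also have "\<dots> = (\<Sum>i\<in>UNIV. P \<alpha> \<gamma> i * Q \<alpha> \<delta> i) -
      \<Lambda> \<alpha> * cnj (\<Lambda> \<alpha>) * (chern_curv H (\<iota> \<gamma>) (\<iota> \<delta>) (\<iota> \<alpha>) (\<iota> \<alpha>) (F z) * \<Lambda> \<gamma> * cnj (\<Lambda> \<delta>))"
    unfolding chern_curv_unitary_frame[of H, OF H1] by (simp add: algebra_simps)
  finally show "pd \<gamma> (pdbar \<delta> (pullback F H \<alpha> \<alpha>)) z =
      (\<Sum>i\<in>UNIV. P \<alpha> \<gamma> i * Q \<alpha> \<delta> i) -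
      \<Lambda> \<alpha> * cnj (\<Lambda> \<alpha>) * (chern_curv H (\<iota> \<gamma>) (\<iota> \<delta>) (\<iota> \<alpha>) (\<iota> \<alpha>) (F z) * \<Lambda> \<gamma> * cnj (\<Lambda> \<delta>))" .
qed

section \<open>The formula on open subsets of coordinate space\<close>

text \<open>The analytic content of the theorem, with a holomorphic \<open>F\<close> and smooth
  families \<open>G\<close>, \<open>H\<close> in place of charts and tangent vectors;
  \<open>a\<close> and \<open>b\<close> only label the coordinates.\<close>

lemma pd_pdbar_ln_minor_quotient:
  fixes F :: "complex^'m::finite \<Rightarrow> complex^'n::finite" and a :: "nat \<Rightarrow> 'm" and b :: "nat \<Rightarrow> 'n"
  defines "m \<equiv> CARD('m)" and "n \<equiv> CARD('n)"
  assumes U: "open U" "z \<in> U" and F: "mholomorphic_on F U"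
    and V: "open V" "F ` U \<subseteq> V" and H: "\<And>i j. smooth_on V (H i j)"
    and S: "open S" "z \<in> S" and G: "\<And>i j. smooth_on S (G i j)"
    and mn: "m \<le> n" and l: "l \<le> m"
    and a: "bij_betw a {1..m} UNIV" and b: "bij_betw b {1..n} UNIV"
    and G1: "\<And>\<alpha> \<beta>. \<alpha> \<in> {1..m} \<Longrightarrow> \<beta> \<in> {1..m} \<Longrightarrow> G (a \<alpha>) (a \<beta>) z = (if \<alpha> = \<beta> then 1 else 0)"
    and H1: "\<And>i j. i \<in> {1..n} \<Longrightarrow> j \<in> {1..n} \<Longrightarrow> H (b i) (b j) (F z) = (if i = j then 1 else 0)"
    and dF: "\<And>\<alpha> i. \<alpha> \<in> {1..m} \<Longrightarrow> i \<in> {1..n} \<Longrightarrow>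
      pd (a \<alpha>) (\<lambda>w. F w $ b i) z = (if i = \<alpha> then lam \<alpha> else 0)"
    and W: "leading_minor a l (pullback F H) z / leading_minor a l G z \<noteq> 0"
    and \<gamma>: "\<gamma> \<in> {1..m}" and \<delta>: "\<delta> \<in> {1..m}"
  defines "P \<equiv> \<lambda>\<alpha> i. pd (a \<alpha>) (pd (a \<gamma>) (\<lambda>w. F w $ b i)) z + pd (b \<gamma>) (H (b \<alpha>) (b i)) (F z) * lam \<alpha> * lam \<gamma>"
    and "Q \<equiv> \<lambda>\<alpha> i. cnj (pd (a \<alpha>) (pd (a \<delta>) (\<lambda>w. F w $ b i)) z) +
      pdbar (b \<delta>) (H (b i) (b \<alpha>)) (F z) * cnj (lam \<alpha>) * cnj (lam \<delta>)"
  shows "pd (a \<gamma>) (pdbar (a \<delta>) (\<lambda>x. ln (leading_minor a l (pullback F H) x / leading_minor a l G x))) z =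
      (\<Sum>\<alpha>=1..l. chern_curv G (a \<gamma>) (a \<delta>) (a \<alpha>) (a \<alpha>) z)
    - (\<Sum>\<alpha>=1..l. chern_curv H (b \<gamma>) (b \<delta>) (b \<alpha>) (b \<alpha>) (F z) * lam \<gamma> * cnj (lam \<delta>))
    - (\<Sum>\<alpha>=1..l. \<Sum>t=l+1..m. pd (a \<gamma>) (G (a \<alpha>) (a t)) z * pdbar (a \<delta>) (G (a t) (a \<alpha>)) z)
    + (\<Sum>\<alpha>=1..l. \<Sum>i=l+1..n. 1 / of_real ((cmod (lam \<alpha>))\<^sup>2) * P \<alpha> i * Q \<alpha> i)"
proof -
  \<comment> \<open>\<open>r\<close> recovers the label of a source index, and
    \<open>\<iota>\<close> sends that index to the target index with the same label, which exists
    because \<open>m \<le> n\<close>.\<close>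
  define r where "r = inv_into {1..m} a"
  define \<iota> where "\<iota> = (\<lambda>k. b (r k))"
  define \<Lambda> where "\<Lambda> = (\<lambda>k. lam (r k))"
  have inja: "inj_on a {1..m}" and injb: "inj_on b {1..n}"
    using a b by (simp_all add: bij_betw_def)
  have r: "r k \<in> {1..m}" "a (r k) = k" for k
    using a unfolding r_def bij_betw_def by (metis inv_into_into UNIV_I, metis f_inv_into_f UNIV_I)
  have ra: "r (a \<alpha>) = \<alpha>" if "\<alpha> \<in> {1..m}" for \<alpha>
    unfolding r_def using inv_into_f_f[OF inja that] .
  have rn: "r k \<in> {1..n}" for k using r(1)[of k] mn by auto
  have \<iota>a: "\<iota> (a \<alpha>) = b \<alpha>" and \<Lambda>a: "\<Lambda> (a \<alpha>) = lam \<alpha>" if "\<alpha> \<in> {1..m}" for \<alpha>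
    using that by (simp_all add: \<iota>_def \<Lambda>_def ra)
  have \<iota>: "inj \<iota>"
    by (rule injI) (metis \<iota>_def r(2) rn inj_onD[OF injb])
  have bE: "\<exists>i'\<in>{1..n}. i = b i'" for i
    using b unfolding bij_betw_def by (metis UNIV_I imageE)
  have H1': "H i j (F z) = (if i = j then 1 else 0)" for i j
    using bE[of i] bE[of j] H1 inj_onD[OF injb] by (metis (mono_tags))
  have G1': "G i j z = (if i = j then 1 else 0)" for i j
    using r[of i] r[of j] G1[of "r i" "r j"] by (metis (mono_tags))
  have dF': "pd \<alpha> (\<lambda>w. F w $ i) z = (if i = \<iota> \<alpha> then \<Lambda> \<alpha> else 0)" for \<alpha> i
  proof -
    obtain i' where i': "i' \<in> {1..n}" "i = b i'" using bE by blast
    have "i = \<iota> \<alpha> \<longleftrightarrow> i' = r \<alpha>"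
      using i' inj_onD[OF injb _ i'(1) rn] by (auto simp: \<iota>_def)
    then show ?thesis
      using dF[OF r(1)[of \<alpha>] i'(1)] by (simp add: r(2) i'(2) \<Lambda>_def)
  qed
  have l1: "\<alpha> \<in> {1..m}" if "\<alpha> \<in> {1..l}" for \<alpha> using that l by auto
  have al: "inj_on a {1..l}" using inja l by (auto intro: inj_on_subset)
  note diag = pullback_diagonal[OF U F V H H1' dF' \<iota>]
  note pbd = pullback_differentiable[OF U(1) F V H]
  note pbd2 = pdbar_pullback_differentiable[OF U(1) F V H U(2), folded pdbar_wirt]
  note Gd = smooth_on_differentiable[OF G]
  note Gd2 = smooth_on_wirt_differentiable[OF S(1) G S(2), where e = "\<i>", folded pdbar_wirt]
  let ?A = "leading_minor a l (pullback F H)" and ?G = "leading_minor a l G"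
  define c where "c = (\<lambda>\<alpha>. of_real ((cmod (lam \<alpha>))\<^sup>2) :: complex)"
  have clam: "lam \<alpha> * cnj (lam \<alpha>) = c \<alpha>" for \<alpha>
    unfolding c_def by (simp only: complex_norm_square)
  have c: "\<Lambda> (a \<alpha>) * cnj (\<Lambda> (a \<alpha>)) = c \<alpha>" if "\<alpha> \<in> {1..m}" for \<alpha>
    unfolding \<Lambda>a[OF that] by (rule clam)
  have Az: "?A z = (\<Prod>\<alpha>=1..l. c \<alpha>)"
  proof -
    have "?A z = (\<Prod>\<alpha>=1..l. \<Lambda> (a \<alpha>) * cnj (\<Lambda> (a \<alpha>)))"
      by (rule leading_minor_diagonal[OF U pbd pbd2[unfolded pdbar_wirt] diag al])
    also have "\<dots> = (\<Prod>\<alpha>=1..l. c \<alpha>)"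
      by (intro prod.cong refl c l1)
    finally show ?thesis .
  qed
  have Gz: "?G z = 1"
    using leading_minor_diagonal[OF S Gd Gd2[unfolded pdbar_wirt] G1' al] by simp
  \<comment> \<open>A zero among the first \<open>l\<close> entries would make the product
    \<open>?A z\<close>, and with it the quotient, vanish.\<close>
  have cnz: "c \<alpha> \<noteq> 0" if "\<alpha> \<in> {1..l}" for \<alpha>
    using W that by (auto simp: Az)
  have "?A z / ?G z = of_real (\<Prod>\<alpha>=1..l. (cmod (lam \<alpha>))\<^sup>2)"
    by (simp add: Az Gz c_def)
  moreover have "0 < (\<Prod>\<alpha>=1..l. (cmod (lam \<alpha>))\<^sup>2)"
    using cnz by (intro prod_pos) (simp add: c_def)
  \<comment> \<open>The quotient at \<open>z\<close> is a positive real number, which keeps it off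
    the cut of \<open>ln\<close>.\<close>
  ultimately have pos: "?A z / ?G z \<notin> \<real>\<^sub>\<le>\<^sub>0"
    by (metis complex_nonpos_Reals_iff Re_complex_of_real not_less)
  have T: "open (U \<inter> S)" "z \<in> U \<inter> S" using U S by auto
  have ln: "pd (a \<gamma>) (pdbar (a \<delta>) (\<lambda>x. ln (?A x / ?G x))) z =
    (pd (a \<gamma>) (pdbar (a \<delta>) ?A) z / ?A z - pdbar (a \<delta>) ?A z * pd (a \<gamma>) ?A z / (?A z)\<^sup>2) -
    (pd (a \<gamma>) (pdbar (a \<delta>) ?G) z / ?G z - pdbar (a \<delta>) ?G z * pd (a \<gamma>) ?G z / (?G z)\<^sup>2)"
    unfolding pd_wirt[of "a \<gamma>"] pdbar_wirt
  proof (rule wirt_wirt_ln_quotient[OF T])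
    show "?A differentiable at x" if "x \<in> U \<inter> S" for x
      using that leading_minor_differentiable[OF U pbd pbd2[unfolded pdbar_wirt] diag al] by blast
    show "?G differentiable at x" if "x \<in> U \<inter> S" for x
      using that leading_minor_differentiable[OF S Gd Gd2[unfolded pdbar_wirt] G1' al] by blast
    show "wirt \<i> (a \<delta>) ?A differentiable at z"
      by (rule wirt_leading_minor_differentiable[OF U pbd pbd2[unfolded pdbar_wirt] diag al])
    show "wirt \<i> (a \<delta>) ?G differentiable at z"
      by (rule wirt_leading_minor_differentiable[OF S Gd Gd2[unfolded pdbar_wirt] G1' al])
    show "?G z \<noteq> 0" by (simp add: Gz)
    show "?A z / ?G z \<notin> \<real>\<^sub>\<le>\<^sub>0" by (rule pos)
  qed
  have lnG: "pd (a \<gamma>) (pdbar (a \<delta>) ?G) z / ?G z - pdbar (a \<delta>) ?G z * pd (a \<gamma>) ?G z / (?G z)\<^sup>2 =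
      (\<Sum>\<alpha>=1..l. pd (a \<gamma>) (pdbar (a \<delta>) (G (a \<alpha>) (a \<alpha>))) z) -
      (\<Sum>\<alpha>=1..l. \<Sum>\<beta>=1..l. pdbar (a \<delta>) (G (a \<alpha>) (a \<beta>)) z * pd (a \<gamma>) (G (a \<beta>) (a \<alpha>)) z)"
    using wirt_wirt_ln_leading_minor[OF S Gd Gd2[unfolded pdbar_wirt] G1' al, of "- \<i>" "a \<gamma>" "a \<delta>"]
    by (simp add: pd_wirt pdbar_wirt)
  have lnA: "pd (a \<gamma>) (pdbar (a \<delta>) ?A) z / ?A z - pdbar (a \<delta>) ?A z * pd (a \<gamma>) ?A z / (?A z)\<^sup>2 =
      (\<Sum>\<alpha>=1..l. pd (a \<gamma>) (pdbar (a \<delta>) (pullback F H (a \<alpha>) (a \<alpha>))) z / c \<alpha>) -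
      (\<Sum>\<alpha>=1..l. \<Sum>\<beta>=1..l. pdbar (a \<delta>) (pullback F H (a \<alpha>) (a \<beta>)) z *
         pd (a \<gamma>) (pullback F H (a \<beta>) (a \<alpha>)) z / (c \<alpha> * c \<beta>))"
  proof -
    have "\<Lambda> (a \<alpha>) * cnj (\<Lambda> (a \<alpha>)) \<noteq> 0" if "\<alpha> \<in> {1..l}" for \<alpha>
      using cnz[OF that] c[OF l1[OF that]] by simp
    note wirt_wirt_ln_leading_minor[OF U pbd pbd2[unfolded pdbar_wirt] diag al this, of "- \<i>" "a \<gamma>" "a \<delta>",
      folded pd_wirt pdbar_wirt]
    also have "(\<Sum>\<alpha>=1..l. pd (a \<gamma>) (pdbar (a \<delta>) (pullback F H (a \<alpha>) (a \<alpha>))) z /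
          (\<Lambda> (a \<alpha>) * cnj (\<Lambda> (a \<alpha>)))) =
        (\<Sum>\<alpha>=1..l. pd (a \<gamma>) (pdbar (a \<delta>) (pullback F H (a \<alpha>) (a \<alpha>))) z / c \<alpha>)"
      by (intro sum.cong refl) (simp only: c[OF l1])
    also have "(\<Sum>\<alpha>=1..l. \<Sum>\<beta>=1..l. pdbar (a \<delta>) (pullback F H (a \<alpha>) (a \<beta>)) z *
         pd (a \<gamma>) (pullback F H (a \<beta>) (a \<alpha>)) z /
          (\<Lambda> (a \<alpha>) * cnj (\<Lambda> (a \<alpha>)) * (\<Lambda> (a \<beta>) * cnj (\<Lambda> (a \<beta>))))) =
       (\<Sum>\<alpha>=1..l. \<Sum>\<beta>=1..l. pdbar (a \<delta>) (pullback F H (a \<alpha>) (a \<beta>)) z *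
         pd (a \<gamma>) (pullback F H (a \<beta>) (a \<alpha>)) z / (c \<alpha> * c \<beta>))"
      by (intro sum.cong refl) (simp only: c[OF l1])
    finally show ?thesis .
  qed
  have trA: "pd (a \<gamma>) (pdbar (a \<delta>) (pullback F H (a \<alpha>) (a \<alpha>))) z / c \<alpha> =
      (\<Sum>i=1..n. 1 / c \<alpha> * P \<alpha> i * Q \<alpha> i) -
      chern_curv H (b \<gamma>) (b \<delta>) (b \<alpha>) (b \<alpha>) (F z) * lam \<gamma> * cnj (lam \<delta>)" if "\<alpha> \<in> {1..l}" for \<alpha>
  proof -
    have "pd (a \<gamma>) (pdbar (a \<delta>) (pullback F H (a \<alpha>) (a \<alpha>))) z =
      (\<Sum>i\<in>UNIV. (pd (a \<alpha>) (pd (a \<gamma>) (\<lambda>w. F w $ i)) z + pd (b \<gamma>) (H (b \<alpha>) i) (F z) * lam \<alpha> * lam \<gamma>) *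
        (cnj (pd (a \<alpha>) (pd (a \<delta>) (\<lambda>w. F w $ i)) z) +
          pdbar (b \<delta>) (H i (b \<alpha>)) (F z) * cnj (lam \<alpha>) * cnj (lam \<delta>))) -
      c \<alpha> * (chern_curv H (b \<gamma>) (b \<delta>) (b \<alpha>) (b \<alpha>) (F z) * lam \<gamma> * cnj (lam \<delta>))"
      unfolding pd_pdbar_pullback_diagonal[OF U F V H H1' dF' \<iota>]
        \<iota>a[OF \<gamma>] \<iota>a[OF \<delta>] \<iota>a[OF l1[OF that]] \<Lambda>a[OF \<gamma>] \<Lambda>a[OF \<delta>] \<Lambda>a[OF l1[OF that]] clam ..
    also have "(\<Sum>i\<in>UNIV. (pd (a \<alpha>) (pd (a \<gamma>) (\<lambda>w. F w $ i)) z + pd (b \<gamma>) (H (b \<alpha>) i) (F z) * lam \<alpha> * lam \<gamma>) *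
        (cnj (pd (a \<alpha>) (pd (a \<delta>) (\<lambda>w. F w $ i)) z) +
          pdbar (b \<delta>) (H i (b \<alpha>)) (F z) * cnj (lam \<alpha>) * cnj (lam \<delta>))) = (\<Sum>i=1..n. P \<alpha> i * Q \<alpha> i)"
      unfolding P_def Q_def by (rule sum.reindex_bij_betw[OF b, symmetric])
    finally show ?thesis
      using cnz[OF that] by (simp add: diff_divide_distrib sum_divide_distrib)
  qed
  \<comment> \<open>The two first derivatives contribute \<open>lam \<alpha>\<close> and
    \<open>cnj (lam \<alpha>)\<close>, whose product cancels \<open>c \<alpha>\<close>. What remains
    are the terms of the trace with index at most \<open>l\<close>.\<close>
  have offA: "(\<Sum>\<alpha>=1..l. \<Sum>\<beta>=1..l. pdbar (a \<delta>) (pullback F H (a \<alpha>) (a \<beta>)) z *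
         pd (a \<gamma>) (pullback F H (a \<beta>) (a \<alpha>)) z / (c \<alpha> * c \<beta>)) =
      (\<Sum>\<beta>=1..l. \<Sum>\<alpha>=1..l. 1 / c \<beta> * P \<beta> \<alpha> * Q \<beta> \<alpha>)"
  proof (subst sum.swap, intro sum.cong refl)
    fix \<alpha> \<beta> assume ab: "\<alpha> \<in> {1..l}" "\<beta> \<in> {1..l}"
    have "pdbar (a \<delta>) (pullback F H (a \<alpha>) (a \<beta>)) z = lam \<alpha> * Q \<beta> \<alpha>"
      unfolding pdbar_pullback_diagonal[OF U F V H H1' dF' \<iota>] Q_def
        \<iota>a[OF \<delta>] \<iota>a[OF l1[OF ab(1)]] \<iota>a[OF l1[OF ab(2)]]
        \<Lambda>a[OF \<delta>] \<Lambda>a[OF l1[OF ab(1)]] \<Lambda>a[OF l1[OF ab(2)]] ..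
    moreover have "pd (a \<gamma>) (pullback F H (a \<beta>) (a \<alpha>)) z = cnj (lam \<alpha>) * P \<beta> \<alpha>"
      unfolding pd_pullback_diagonal[OF U F V H H1' dF' \<iota>] P_def
        \<iota>a[OF \<gamma>] \<iota>a[OF l1[OF ab(1)]] \<iota>a[OF l1[OF ab(2)]]
        \<Lambda>a[OF \<gamma>] \<Lambda>a[OF l1[OF ab(1)]] \<Lambda>a[OF l1[OF ab(2)]] ..
    moreover note clam[of \<alpha>, symmetric]
    ultimately show "pdbar (a \<delta>) (pullback F H (a \<alpha>) (a \<beta>)) z *
         pd (a \<gamma>) (pullback F H (a \<beta>) (a \<alpha>)) z / (c \<alpha> * c \<beta>) = 1 / c \<beta> * P \<beta> \<alpha> * Q \<beta> \<alpha>"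
      using cnz[OF ab(1)] cnz[OF ab(2)] by (simp add: field_simps)
  qed
  have split_n: "(\<Sum>i=1..n. g i) = (\<Sum>i=1..l. g i) + (\<Sum>i=l+1..n. g i)" for g :: "nat \<Rightarrow> complex"
    using sum.ub_add_nat[of 1 l g "n - l"] l mn by simp
  have split_m: "(\<Sum>i=1..m. g i) = (\<Sum>i=1..l. g i) + (\<Sum>i=l+1..m. g i)" for g :: "nat \<Rightarrow> complex"
    using sum.ub_add_nat[of 1 l g "m - l"] l by simp
  \<comment> \<open>The curvature formula in a unitary frame, solved for the second derivative of
    the metric.\<close>
  have trG: "pd (a \<gamma>) (pdbar (a \<delta>) (G (a \<alpha>) (a \<alpha>))) z =
      (\<Sum>t=1..m. pd (a \<gamma>) (G (a \<alpha>) (a t)) z * pdbar (a \<delta>) (G (a t) (a \<alpha>)) z) -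
      chern_curv G (a \<gamma>) (a \<delta>) (a \<alpha>) (a \<alpha>) z" for \<alpha>
    unfolding chern_curv_unitary_frame[of G, OF G1']
    using sum.reindex_bij_betw[OF a, of "\<lambda>t. pd (a \<gamma>) (G (a \<alpha>) t) z * pdbar (a \<delta>) (G t (a \<alpha>)) z"]
    by simp
  have offG: "(\<Sum>\<alpha>=1..l. \<Sum>\<beta>=1..l. pdbar (a \<delta>) (G (a \<alpha>) (a \<beta>)) z * pd (a \<gamma>) (G (a \<beta>) (a \<alpha>)) z) =
      (\<Sum>\<beta>=1..l. \<Sum>\<alpha>=1..l. pd (a \<gamma>) (G (a \<beta>) (a \<alpha>)) z * pdbar (a \<delta>) (G (a \<alpha>) (a \<beta>)) z)"
    by (subst sum.swap) (simp add: mult.commute)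
  have sA: "(\<Sum>\<alpha>=1..l. pd (a \<gamma>) (pdbar (a \<delta>) (pullback F H (a \<alpha>) (a \<alpha>))) z / c \<alpha>) =
      (\<Sum>\<alpha>=1..l. (\<Sum>i=1..n. 1 / c \<alpha> * P \<alpha> i * Q \<alpha> i) -
      chern_curv H (b \<gamma>) (b \<delta>) (b \<alpha>) (b \<alpha>) (F z) * lam \<gamma> * cnj (lam \<delta>))"
    by (intro sum.cong refl trA)
  \<comment> \<open>Splitting the traces at \<open>l\<close> cancels the double sums. The logarithm
    of the metric minor is subtracted, so its curvature enters with a plus sign and its sum over
    \<open>t > l\<close> with a minus sign.\<close>
  show ?thesis
    unfolding ln lnA lnG sA trG offA offG
    unfolding split_n split_m sum.distrib sum_subtractf c_def by simp
qed

section \<open>Charts, coordinate vectors and the tangent map in local coordinates\<close>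

section \<open>Passage from the manifolds to coordinates\<close>

lemma is_chart_inj_on:
  assumes "is_chart X c"
  shows "inj_on (snd c) (fst c)"
proof -
  have "inj_on (snd c) (topspace (subtopology X (fst c)))"
    using assms unfolding is_chart_def by (blast intro: homeomorphic_imp_injective_map)
  moreover have "fst c \<subseteq> topspace X"
    using assms unfolding is_chart_def by (blast dest: openin_subset)
  ultimately show ?thesis by (simp add: Int_absorb1)
qed

lemma chart_inv_apply: "is_chart X c \<Longrightarrow> p \<in> fst c \<Longrightarrow> chart_inv c (snd c p) = p"
  unfolding chart_inv_def by (rule inv_into_f_f[OF is_chart_inj_on])

lemma open_chart_image:
  assumes c: "is_chart X c" and T: "openin X T" "T \<subseteq> fst c"
  shows "open (snd c ` T)"
proof -
  have "open_map (subtopology X (fst c)) (top_of_set (snd c ` fst c)) (snd c)"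
    using c unfolding is_chart_def by (blast intro: homeomorphic_imp_open_map)
  moreover have "openin (subtopology X (fst c)) T"
    using T c unfolding is_chart_def by (simp add: openin_open_subtopology)
  ultimately have "openin (top_of_set (snd c ` fst c)) (snd c ` T)"
    by (simp add: open_map_def)
  moreover have "open (snd c ` fst c)"
    using c unfolding is_chart_def by blast
  ultimately show ?thesis by (rule openin_open_trans)
qed

lemma jac_axis: "(jac F z *v axis k 1) $ i = pd k (\<lambda>w. F w $ i) z"
proof -
  have "(jac F z *v axis k 1) $ i = (\<Sum>j\<in>UNIV. if j = k then pd j (\<lambda>w. F w $ i) z else 0)"
    unfolding matrix_vector_mult_def by (simp add: jac_def axis_def if_distrib cong: if_cong)
  then show ?thesis by simp
qed

text \<open>The transition map of a chart to itself is the identity on the chart image, where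
  \<open>chart_inv\<close> is a genuine inverse. That image is open, so the derivatives agree
  there.\<close>

lemma coord_vec_self:
  assumes c: "is_chart X c" "c \<in> A" "p \<in> fst c"
  shows "coord_vec A c p k c = axis k 1"
proof -
  have op: "open (snd c ` fst c)" using c(1) unfolding is_chart_def by blast
  have "coord_vec A c p k c = jac (trans_map c c) (snd c p) *v axis k 1"
    using c by (simp add: coord_vec_def)
  also have "\<dots> = axis k 1"
    unfolding Finite_Cartesian_Product.vec_eq_iff jac_axis
  proof
    fix i
    have "pd k (\<lambda>w. trans_map c c w $ i) (snd c p) = pd k (\<lambda>w. w $ i) (snd c p)"
      using c by (intro pd_cong[OF op]) (auto simp: trans_map_def chart_inv_apply)
    also have "\<dots> = axis k 1 $ i"
      unfolding pd_wirt wirt_has_derivative[OF bounded_linear_imp_has_derivative[OF bounded_linear_vec_nth]]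
      by (simp add: axis_def)
    finally show "pd k (\<lambda>w. trans_map c c w $ i) (snd c p) = axis k 1 $ i" .
  qed
  finally show ?thesis .
qed

text \<open>\<open>tangent_map\<close> computes in a chart chosen arbitrarily. The transformation
  law of coordinate vectors supplies the Jacobian from \<open>c\<close> to that chart, and the chain
  rule absorbs it, giving the derivative in \<open>c\<close> itself.\<close>

lemma tangent_map_coord_vec:
  assumes X: "complex_manifold X A" and f: "holomorphic_map X A Y B f"
    and c: "c \<in> A" "p \<in> fst c" and d: "d \<in> B" "openin Y (fst d)" "f p \<in> fst d"
  shows "tangent_map A B f p (coord_vec A c p k) d $ i = pd k (\<lambda>w. loc_rep c d f w $ i) (snd c p)"
proof -
  \<comment> \<open>The chart selected inside \<open>tangent_map\<close>; only its membership in the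
    atlas and the fact that it contains \<open>p\<close> are known.\<close>
  define c' where "c' = (SOME c. c \<in> A \<and> p \<in> fst c)"
  have "c' \<in> A \<and> p \<in> fst c'"
    unfolding c'_def by (rule someI[of _ c]) (use c in blast)
  then have c': "c' \<in> A" "p \<in> fst c'" by auto
  have ch: "is_chart X c" "is_chart X c'" and comp: "compatible c c'"
    using X c c' unfolding complex_manifold_def by blast+
  let ?T = "trans_map c c'" and ?F = "loc_rep c' d f"
  let ?N = "snd c ` (fst c \<inter> fst c')"
  have opN: "open ?N"
    using ch by (intro open_chart_image[OF ch(1)]) (auto simp: is_chart_def)
  have pN: "snd c p \<in> ?N" using c c' by blast
  have T: "mholomorphic_on ?T ?N" using comp unfolding compatible_def by blast
  have Tp: "?T (snd c p) = snd c' p"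
    using c by (simp add: trans_map_def chart_inv_apply[OF ch(1)])
  have "mholomorphic_on ?F (snd c' ` (fst c' \<inter> f -` fst d))"
    using f c' d unfolding holomorphic_map_def by blast
  then have F: "(\<lambda>w. ?F w $ i) differentiable at (?T (snd c p))"
    unfolding Tp using c' d by (intro cholomorphic_on_differentiable[OF cholomorphic_on_component]) auto
  have "tangent_map A B f p (coord_vec A c p k) d = jac ?F (snd c' p) *v (jac ?T (snd c p) *v axis k 1)"
    using c c' d by (simp add: tangent_map_def coord_vec_def Let_def c'_def[symmetric])
  then have "tangent_map A B f p (coord_vec A c p k) d $ i =
      (\<Sum>j\<in>UNIV. pd j (\<lambda>w. ?F w $ i) (snd c' p) * pd k (\<lambda>w. ?T w $ j) (snd c p))"
    by (simp add: matrix_vector_mult_def[of "jac ?F (snd c' p)"] jac_axis) (simp add: jac_def)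
  also have "\<dots> = pd k (\<lambda>w. ?F (?T w) $ i) (snd c p)"
    using pd_mholomorphic_chain[OF T pN F] by (simp add: Tp)
  \<comment> \<open>Near \<open>snd c p\<close> the intermediate chart cancels from the composite,
    but this identity holds only on the overlap of the two charts.\<close>
  also have "\<dots> = pd k (\<lambda>w. loc_rep c d f w $ i) (snd c p)"
    by (rule pd_cong[OF opN pN])
      (auto simp: loc_rep_def trans_map_def chart_inv_apply[OF ch(1)] chart_inv_apply[OF ch(2)])
  finally show ?thesis .
qed

theorem theorem1p1:
  fixes X :: "'a topology" and A :: "('a, 'm::finite) chart set" and g :: "('a, 'm) metric"
    and Y :: "'b topology" and B :: "('b, 'n::finite) chart set" and h :: "('b, 'n) metric"
    and f :: "'a \<Rightarrow> 'b" and p :: 'a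
    and c :: "('a, 'm) chart" and d :: "('b, 'n) chart"
    and a :: "nat \<Rightarrow> 'm" and b :: "nat \<Rightarrow> 'n"
    and m n l :: nat and lam :: "nat \<Rightarrow> complex"
  defines "m \<equiv> CARD('m)" and "n \<equiv> CARD('n)"
  assumes M: "hermitian_manifold X A g" and N: "hermitian_manifold Y B h"
    and f: "holomorphic_map X A Y B f"
    and mn: "m \<le> n" and l: "1 \<le> l" "l \<le> m"
    and p: "p \<in> topspace X"
    and c: "c \<in> A" "p \<in> fst c" and d: "d \<in> B" "f p \<in> fst d"
    and a: "bij_betw a {1..m} UNIV" and b: "bij_betw b {1..n} UNIV"
    and g_p: "\<forall>\<alpha>\<in>{1..m}. \<forall>\<beta>\<in>{1..m}.
      metric_coeff A g c (a \<alpha>) (a \<beta>) (snd c p) = (if \<alpha> = \<beta> then 1 else 0)"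
    and h_fp: "\<forall>i\<in>{1..n}. \<forall>j\<in>{1..n}.
      metric_coeff B h d (b i) (b j) (snd d (f p)) = (if i = j then 1 else 0)"
    and df_p: "\<forall>\<alpha>\<in>{1..m}. tangent_map A B f p (coord_vec A c p (a \<alpha>)) =
      (\<lambda>e. \<Sum>i=1..n. (lam \<alpha> * (if i = \<alpha> then 1 else 0)) *s coord_vec B d (f p) (b i) e)"
    and lam_ord: "\<forall>\<alpha>\<in>{1..m}. \<forall>\<beta>\<in>{1..m}. \<alpha> \<le> \<beta> \<longrightarrow> cmod (lam \<beta>) \<le> cmod (lam \<alpha>)"
    and W_p: "W_quot A g B h c d f a l (snd c p) \<noteq> 0"
  shows "\<forall>\<gamma>\<in>{1..m}. \<forall>\<delta>\<in>{1..m}.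
    (let G = metric_coeff A g c; H = metric_coeff B h d;
         z = snd c p; w = snd d (f p);
         f2 = (\<lambda>i \<alpha> \<gamma>. pd (a \<alpha>) (pd (a \<gamma>) (\<lambda>x. loc_rep c d f x $ b i)) z)
     in pd (a \<gamma>) (pdbar (a \<delta>) (\<lambda>x. ln (W_quot A g B h c d f a l x))) z =
        (\<Sum>\<alpha>=1..l. chern_curv G (a \<gamma>) (a \<delta>) (a \<alpha>) (a \<alpha>) z)
      - (\<Sum>\<alpha>=1..l. chern_curv H (b \<gamma>) (b \<delta>) (b \<alpha>) (b \<alpha>) w * lam \<gamma> * cnj (lam \<delta>))
      - (\<Sum>\<alpha>=1..l. \<Sum>t=l+1..m.
           pd (a \<gamma>) (G (a \<alpha>) (a t)) z * pdbar (a \<delta>) (G (a t) (a \<alpha>)) z)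
      + (\<Sum>\<alpha>=1..l. \<Sum>i=l+1..n. 1 / of_real ((cmod (lam \<alpha>))\<^sup>2) *
           (f2 i \<alpha> \<gamma> + pd (b \<gamma>) (H (b \<alpha>) (b i)) w * lam \<alpha> * lam \<gamma>) *
           (cnj (f2 i \<alpha> \<delta>) + pdbar (b \<delta>) (H (b i) (b \<alpha>)) w * cnj (lam \<alpha>) * cnj (lam \<delta>))))"
proof (intro ballI)
  fix \<gamma> \<delta> assume \<gamma>\<delta>: "\<gamma> \<in> {1..m}" "\<delta> \<in> {1..m}"
  have X: "complex_manifold X A" and gm: "hermitian_metric X A g"
    and Y: "complex_manifold Y B" and hm: "hermitian_metric Y B h"
    using M N unfolding hermitian_manifold_def by auto
  have chc: "is_chart X c" and chd: "is_chart Y d"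
    using X Y c d unfolding complex_manifold_def by blast+
  have openc: "openin X (fst c)" "open (snd c ` fst c)" and opend: "openin Y (fst d)" "open (snd d ` fst d)"
    using chc chd unfolding is_chart_def by blast+
  let ?F = "loc_rep c d f" and ?U = "snd c ` (fst c \<inter> f -` fst d)"
  have "continuous_map X Y f" using f unfolding holomorphic_map_def by blast
  from openin_continuous_map_preimage_gen[OF this openc(1) opend(1)]
  have "openin X (fst c \<inter> f -` fst d)" by (simp add: Int_def vimage_def)
  then have U: "open ?U" by (rule open_chart_image[OF chc]) blast
  have zU: "snd c p \<in> ?U" using c d by blast
  have F: "mholomorphic_on ?F ?U" using f c d unfolding holomorphic_map_def by blast
  have Fp: "?F (snd c p) = snd d (f p)"
    using c by (simp add: loc_rep_def chart_inv_apply[OF chc])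
  have FU: "?F ` ?U \<subseteq> snd d ` fst d"
    by (auto simp: loc_rep_def chart_inv_apply[OF chc])
  have G: "smooth_on (snd c ` fst c) (metric_coeff A g c i j)" for i j
    using gm c unfolding hermitian_metric_def by blast
  have H: "smooth_on (snd d ` fst d) (metric_coeff B h d i j)" for i j
    using hm d unfolding hermitian_metric_def by blast
  \<comment> \<open>The hypothesis on the tangent map is read in the chart \<open>d\<close>, where
    the coordinate vectors are unit vectors, so component \<open>b i\<close> selects the summand
    \<open>j = i\<close>.\<close>
  have dF: "pd (a \<alpha>) (\<lambda>w. ?F w $ b i) (snd c p) = (if i = \<alpha> then lam \<alpha> else 0)"
    if \<alpha>: "\<alpha> \<in> {1..m}" and i: "i \<in> {1..n}" for \<alpha> i
  proof -
    have b_eq: "b i = b j \<longleftrightarrow> i = j" if "j \<in> {1..n}" for j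
      using b i that unfolding bij_betw_def by (auto dest: inj_onD)
    have "pd (a \<alpha>) (\<lambda>w. ?F w $ b i) (snd c p) =
        tangent_map A B f p (coord_vec A c p (a \<alpha>)) d $ b i"
      by (rule tangent_map_coord_vec[OF X f c d(1) opend(1) d(2), symmetric])
    also have "\<dots> = (\<Sum>j=1..n. (lam \<alpha> * (if j = \<alpha> then 1 else 0)) *s coord_vec B d (f p) (b j) d) $ b i"
      using df_p \<alpha> by simp
    also have "\<dots> = (\<Sum>j=1..n. (lam \<alpha> * (if j = \<alpha> then 1 else 0)) * (axis (b j) 1 $ b i))"
      by (simp add: coord_vec_self[OF chd d])
    also have "\<dots> = (\<Sum>j=1..n. if j = i then lam \<alpha> * (if i = \<alpha> then 1 else 0) else 0)"
      by (intro sum.cong refl) (auto simp: axis_def b_eq)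
    also have "\<dots> = (if i = \<alpha> then lam \<alpha> else 0)"
      using i by simp
    finally show ?thesis .
  qed
  have W: "W_quot A g B h c d f a l =
      (\<lambda>x. leading_minor a l (pullback ?F (metric_coeff B h d)) x / leading_minor a l (metric_coeff A g c) x)"
  proof -
    have eq: "pullback_coeff B h c d f = pullback ?F (metric_coeff B h d)"
      by (simp add: fun_eq_iff pullback_coeff_def pullback_def)
    show ?thesis by (rule ext) (simp only: W_quot_def eq)
  qed
  have zc: "snd c p \<in> snd c ` fst c" using c by blast
  \<comment> \<open>The domain for \<open>?F\<close> is the part of the chart image that
    \<open>f\<close> carries into the chart \<open>d\<close>, while the metric coefficients are
    smooth on the full chart images; hence three separate open sets.\<close>
  note local_formula = pd_pdbar_ln_minor_quotient[OF U zU F opend(2) FU H openc(2) zc G]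
  show "let G = metric_coeff A g c; H = metric_coeff B h d;
         z = snd c p; w = snd d (f p);
         f2 = (\<lambda>i \<alpha> \<gamma>. pd (a \<alpha>) (pd (a \<gamma>) (\<lambda>x. loc_rep c d f x $ b i)) z)
     in pd (a \<gamma>) (pdbar (a \<delta>) (\<lambda>x. ln (W_quot A g B h c d f a l x))) z =
        (\<Sum>\<alpha>=1..l. chern_curv G (a \<gamma>) (a \<delta>) (a \<alpha>) (a \<alpha>) z)
      - (\<Sum>\<alpha>=1..l. chern_curv H (b \<gamma>) (b \<delta>) (b \<alpha>) (b \<alpha>) w * lam \<gamma> * cnj (lam \<delta>))
      - (\<Sum>\<alpha>=1..l. \<Sum>t=l+1..m.
           pd (a \<gamma>) (G (a \<alpha>) (a t)) z * pdbar (a \<delta>) (G (a t) (a \<alpha>)) z)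
      + (\<Sum>\<alpha>=1..l. \<Sum>i=l+1..n. 1 / of_real ((cmod (lam \<alpha>))\<^sup>2) *
           (f2 i \<alpha> \<gamma> + pd (b \<gamma>) (H (b \<alpha>) (b i)) w * lam \<alpha> * lam \<gamma>) *
           (cnj (f2 i \<alpha> \<delta>) + pdbar (b \<delta>) (H (b i) (b \<alpha>)) w * cnj (lam \<alpha>) * cnj (lam \<delta>)))"
    unfolding Let_def W Fp[symmetric] m_def n_def
  proof (rule local_formula)
    show "CARD('m) \<le> CARD('n)" "l \<le> CARD('m)" "bij_betw a {1..CARD('m)} UNIV" "bij_betw b {1..CARD('n)} UNIV"
      using mn l a b by (simp_all add: m_def n_def)
    show "metric_coeff A g c (a \<alpha>) (a \<beta>) (snd c p) = (if \<alpha> = \<beta> then 1 else 0)"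
      if "\<alpha> \<in> {1..CARD('m)}" "\<beta> \<in> {1..CARD('m)}" for \<alpha> \<beta>
      using g_p that by (simp add: m_def)
    show "metric_coeff B h d (b i) (b j) (?F (snd c p)) = (if i = j then 1 else 0)"
      if "i \<in> {1..CARD('n)}" "j \<in> {1..CARD('n)}" for i j
      using h_fp that by (simp add: n_def Fp)
    show "pd (a \<alpha>) (\<lambda>w. ?F w $ b i) (snd c p) = (if i = \<alpha> then lam \<alpha> else 0)"
      if "\<alpha> \<in> {1..CARD('m)}" "i \<in> {1..CARD('n)}" for \<alpha> i
      using dF that by (simp add: m_def n_def)
    show "leading_minor a l (pullback ?F (metric_coeff B h d)) (snd c p) /
        leading_minor a l (metric_coeff A g c) (snd c p) \<noteq> 0"
      using W_p by (simp add: W)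
    show "\<gamma> \<in> {1..CARD('m)}" "\<delta> \<in> {1..CARD('m)}"
      using \<gamma>\<delta> by (simp_all add: m_def)
  qed
qed

end
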